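(* Let $b\ge 2$ and let $S$ be a standard skew tableau with $b$ nonempty rows whose row vector is decreasing (row lengths weakly decrease from top to bottom). Then $S$ stabilizes at $2b-2$.
   Context: Tableaux use English notation; rows are indexed from top to bottom. A standard skew tableau with $m$ cells is a filling of a skew shape by $1,\dots,m$, each used once, increasing along rows and down columns. The row vector of a skew tableau is the sequence of its row lengths from top to bottom; it is "decreasing" if these lengths weakly decrease from top to bottom. $\operatorname{Rect}(S)$ denotes the jeu de taquin rectification of $S$. For a standard skew tableau $S$ with $m$ cells and decreasing row vector and $k\ge 1$, $S^{(k)}$ is the standard skew tableau obtained by attaching $k-1$ shifted copies of $S$ to the right of $S$: row $i$ of $S^{(k)}$ begins in the same column as row $i$ of $S$ and consists of the entries of row $i$ of $S$, followed by these entries plus $m$, followed by these entries plus $2m$, ..., followed by these entries plus $(k-1)m$. $S$ stabilizes at $k$ if every entry in $[(k-1)m+1,km]$ lies in the same row of $\operatorname{Rect}(S^{(k)})$ as in $S^{(k)}$. *)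

theory Defs
  imports Main
begin

text \<open>Tableaux in English notation: a cell is (row, column), rows indexed from the top
  starting at 0, columns from the left starting at 0.  A (partial) tableau is a finite
  map from cells to entries.\<close>

type_synonym tableau = "(nat \<times> nat) \<Rightarrow> nat option"

definition weakly_decr :: "nat list \<Rightarrow> bool" where
  "weakly_decr xs \<longleftrightarrow> (\<forall>i j. i \<le> j \<longrightarrow> j < length xs \<longrightarrow> xs ! j \<le> xs ! i)"

definition skew_cells :: "nat list \<Rightarrow> nat list \<Rightarrow> (nat \<times> nat) set" where
  "skew_cells lam mu = {(i, j). i < length lam \<and> mu ! i \<le> j \<and> j < lam ! i}"

definition standard_filling :: "tableau \<Rightarrow> bool" where
  "standard_filling T \<longleftrightarrow>
     finite (dom T) \<and>
     bij_betw (\<lambda>c. the (T c)) (dom T) {1..card (dom T)} \<and>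
     (\<forall>i j j' a c. j < j' \<longrightarrow> T (i, j) = Some a \<longrightarrow> T (i, j') = Some c \<longrightarrow> a < c) \<and>
     (\<forall>i i' j a c. i < i' \<longrightarrow> T (i, j) = Some a \<longrightarrow> T (i', j) = Some c \<longrightarrow> a < c)"

definition row_start :: "tableau \<Rightarrow> nat \<Rightarrow> nat" where
  "row_start T i = Min {j. (i, j) \<in> dom T}"

definition row_len :: "tableau \<Rightarrow> nat \<Rightarrow> nat" where
  "row_len T i = card {j. (i, j) \<in> dom T}"

definition tab_power :: "tableau \<Rightarrow> nat \<Rightarrow> tableau" where
  "tab_power S k = (\<lambda>(i, j).
     (let s = row_start S i; r = row_len S i; m = card (dom S) in
      if s \<le> j \<and> j < s + k * r
      then map_option (\<lambda>x. x + ((j - s) div r) * m) (S (i, s + (j - s) mod r))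
      else None))"

text \<open>Jeu de taquin.  The inner region of a skew tableau: empty cells weakly north-west
  of some filled cell (i.e. the relevant cells of the inner shape).\<close>
definition inner_region :: "tableau \<Rightarrow> (nat \<times> nat) set" where
  "inner_region T = {c. c \<notin> dom T \<and> (\<exists>d\<in>dom T. fst c \<le> fst d \<and> snd c \<le> snd d)}"

definition inner_corner :: "tableau \<Rightarrow> nat \<times> nat" where
  "inner_corner T = (let i = Max (fst ` inner_region T) in (i, Max {j. (i, j) \<in> inner_region T}))"

text \<open>One forward slide moving the hole at (i,j); the fuel argument bounds the number of moves
  (card of the domain suffices, since the hole moves strictly south-east).\<close>
fun slide :: "nat \<Rightarrow> tableau \<Rightarrow> nat \<times> nat \<Rightarrow> tableau" where
  "slide 0 T h = T"
| "slide (Suc n) T (i, j) =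
     (case (T (Suc i, j), T (i, Suc j)) of
        (None, None) \<Rightarrow> T
      | (Some a, None) \<Rightarrow> slide n (T((i, j) := Some a, (Suc i, j) := None)) (Suc i, j)
      | (None, Some c) \<Rightarrow> slide n (T((i, j) := Some c, (i, Suc j) := None)) (i, Suc j)
      | (Some a, Some c) \<Rightarrow>
          (if a < c then slide n (T((i, j) := Some a, (Suc i, j) := None)) (Suc i, j)
           else slide n (T((i, j) := Some c, (i, Suc j) := None)) (i, Suc j)))"

definition rect_step :: "tableau \<Rightarrow> tableau" where
  "rect_step T = (if inner_region T = {} then T
                  else slide (card (dom T)) T (inner_corner T))"

text \<open>Jeu de taquin rectification: slide into inner corners until the inner region is empty
  (each slide removes one cell of the inner region).\<close>
definition Rect :: "tableau \<Rightarrow> tableau" where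
  "Rect T = (rect_step ^^ card (inner_region T)) T"

definition stabilizes_at :: "tableau \<Rightarrow> nat \<Rightarrow> bool" where
  "stabilizes_at S k \<longleftrightarrow>
     (let m = card (dom S); Sk = tab_power S k in
      \<forall>i j x. Sk (i, j) = Some x \<longrightarrow> (k - 1) * m + 1 \<le> x \<longrightarrow> x \<le> k * m \<longrightarrow>
        (\<exists>j'. Rect Sk (i, j') = Some x))"

end

theory Submission
  imports Defs
begin

text \<open>
  Rectification works upwards from the bottom row: in phase \<open>i\<close> row \<open>i\<close> is slid to the left
  while the rows below already form a straight shape.  When the hole moves down from row \<open>q\<close>,
  the entry \<open>a\<close> moving up is the least \<open>x\<close> at which the number of entries \<open>\<le> x\<close> of row \<open>q + 1\<close>
  exceeds that of row \<open>q\<close> by the maximal amount the column condition allows.  Consequently, within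
  a phase, the entries moving from row \<open>q + 1\<close> to row \<open>q\<close> decrease from slide to slide, so only
  the first of them has to be bounded.  If both rows still agree with the power of \<open>S\<close>
  beyond some block, the difference of the two counts does not increase over a further block, because row lengths
  decrease; hence the first \<open>a\<close> lies at most one block further.  Adding up over phases and rows,
  the entries crossing between rows \<open>q\<close> and \<open>q + 1\<close> in phase \<open>i\<close> lie in the first
  \<open>(b - 1 - i) + (q - i) \<le> 2b - 3\<close> blocks.
\<close>

section \<open>Entries of a row and their counting functions\<close>

definition rowset :: "tableau \<Rightarrow> nat \<Rightarrow> nat set" where
  "rowset T r = {x. \<exists>c. T (r, c) = Some x}"

definition cnt :: "nat set \<Rightarrow> nat \<Rightarrow> nat" where
  "cnt R x = card {y \<in> R. y \<le> x}"

lemma cnt_0: "0 \<notin> R \<Longrightarrow> cnt R 0 = 0"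
  by (auto simp: cnt_def)

lemma cnt_Suc: "cnt R (Suc x) = cnt R x + (if Suc x \<in> R then 1 else 0)"
proof (cases "Suc x \<in> R")
  case True
  then have "{y \<in> R. y \<le> Suc x} = insert (Suc x) {y \<in> R. y \<le> x}"
    by (auto simp: le_Suc_eq)
  with True show ?thesis by (simp add: cnt_def)
next
  case False
  then have "{y \<in> R. y \<le> Suc x} = {y \<in> R. y \<le> x}"
    by (auto simp: le_Suc_eq)
  with False show ?thesis by (simp add: cnt_def)
qed

lemma cnt_insert:
  assumes "a \<notin> R"
  shows "cnt (insert a R) x = cnt R x + (if a \<le> x then 1 else 0)"
proof (cases "a \<le> x")
  case True
  then have "{y \<in> insert a R. y \<le> x} = insert a {y \<in> R. y \<le> x}" by auto
  with True assms show ?thesis by (simp add: cnt_def)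
next
  case False
  then have "{y \<in> insert a R. y \<le> x} = {y \<in> R. y \<le> x}" by auto
  with False show ?thesis by (simp add: cnt_def)
qed

lemma cnt_remove:
  assumes "a \<in> R"
  shows "cnt (R - {a}) x + (if a \<le> x then 1 else 0) = cnt R x"
  using cnt_insert[of a "R - {a}" x] assms by (simp add: insert_absorb)

text \<open>Carries the window inequality from the original rows to rows that slides have altered
  only in earlier blocks. Both sides are sums because subtraction on \<open>nat\<close>
  truncates.\<close>

lemma cnt_agree_above:
  assumes "\<And>y. x < y \<Longrightarrow> y \<in> R \<longleftrightarrow> y \<in> R'"
  shows "cnt R (x + d) + cnt R' x = cnt R x + cnt R' (x + d)"
proof (induction d)
  case (Suc d)
  then show ?case using assms[of "Suc (x + d)"] by (simp add: cnt_Suc)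
qed simp

lemma cnt_periodic:
  assumes "\<And>y. 0 < y \<Longrightarrow> y + m \<le> N \<Longrightarrow> y \<in> R \<longleftrightarrow> y + m \<in> R" and "0 \<notin> R"
    and "x + m \<le> N"
  shows "cnt R (x + m) = cnt R x + cnt R m"
  using assms(3)
proof (induction x)
  case 0
  then show ?case using assms(2) by (simp add: cnt_0)
next
  case (Suc x)
  then show ?case using assms(1)[of "Suc x"] by (simp add: cnt_Suc)
qed

text \<open>Bridge between the counts, which see only the set of entries of a row, and the positions
  of these entries in the tableau.\<close>

lemma cnt_eq_card_columns:
  assumes "\<And>c c' x. T (r, c) = Some x \<Longrightarrow> T (r, c') = Some x \<Longrightarrow> c = c'"
  shows "cnt (rowset T r) x = card {c. \<exists>y \<le> x. T (r, c) = Some y}"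
proof -
  have "bij_betw (\<lambda>c. the (T (r, c))) {c. \<exists>y \<le> x. T (r, c) = Some y}
      {y \<in> rowset T r. y \<le> x}"
    unfolding bij_betw_def
  proof
    show "inj_on (\<lambda>c. the (T (r, c))) {c. \<exists>y \<le> x. T (r, c) = Some y}"
    proof (rule inj_onI, clarify)
      fix c c' y y' assume "T (r, c) = Some y" "T (r, c') = Some y'" "the (T (r, c)) = the (T (r, c'))"
      then show "c = c'" using assms[of c y c'] by simp
    qed
    show "(\<lambda>c. the (T (r, c))) ` {c. \<exists>y \<le> x. T (r, c) = Some y} = {y \<in> rowset T r. y \<le> x}"
    proof (intro set_eqI iffI)
      fix y assume "y \<in> {y \<in> rowset T r. y \<le> x}"
      then obtain c where "T (r, c) = Some y" "y \<le> x" by (auto simp: rowset_def)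
      then show "y \<in> (\<lambda>c. the (T (r, c))) ` {c. \<exists>y \<le> x. T (r, c) = Some y}"
        by (intro image_eqI[of _ _ c]) auto
    qed (auto simp: rowset_def)
  qed
  then show ?thesis unfolding cnt_def by (simp add: bij_betw_same_card)
qed

section \<open>Skew tableaux with holes and the two elementary moves\<close>

text \<open>\<open>s\<close> and \<open>e\<close> give the first column of a row and the column after its last one; \<open>H\<close> is the
  set of holes.\<close>
definition skew_tab :: "(nat \<Rightarrow> nat) \<Rightarrow> (nat \<Rightarrow> nat) \<Rightarrow> (nat \<times> nat) set \<Rightarrow> tableau \<Rightarrow> bool" where
  "skew_tab s e H T \<longleftrightarrow>
     antimono s \<and> antimono e \<and> (\<forall>r. s r \<le> e r) \<and>
     dom T = {(r, c). s r \<le> c \<and> c < e r} - H \<and>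
     (\<forall>r c c' x y. c < c' \<longrightarrow> T (r, c) = Some x \<longrightarrow> T (r, c') = Some y \<longrightarrow> x < y) \<and>
     (\<forall>r r' c x y. r < r' \<longrightarrow> T (r, c) = Some x \<longrightarrow> T (r', c) = Some y \<longrightarrow> x < y) \<and>
     (\<forall>p p' x. T p = Some x \<longrightarrow> T p' = Some x \<longrightarrow> p = p')"

lemma
  assumes "skew_tab s e H T"
  shows skew_antimono_s: "r \<le> r' \<Longrightarrow> s r' \<le> s r"
    and skew_antimono_e: "r \<le> r' \<Longrightarrow> e r' \<le> e r"
    and skew_le: "s r \<le> e r"
    and skew_dom: "dom T = {(r, c). s r \<le> c \<and> c < e r} - H"
    and skew_row: "c < c' \<Longrightarrow> T (r, c) = Some x \<Longrightarrow> T (r, c') = Some y \<Longrightarrow> x < y"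
    and skew_col: "r < r' \<Longrightarrow> T (r, c) = Some x \<Longrightarrow> T (r', c) = Some y \<Longrightarrow> x < y"
    and skew_inj: "T p = Some x \<Longrightarrow> T p' = Some x \<Longrightarrow> p = p'"
proof -
  have "antimono s"
    using assms unfolding skew_tab_def by (elim conjE)
  then show "r \<le> r' \<Longrightarrow> s r' \<le> s r" by (rule antimonoD)
  have "antimono e"
    using assms unfolding skew_tab_def by (elim conjE)
  then show "r \<le> r' \<Longrightarrow> e r' \<le> e r" by (rule antimonoD)
  have "\<forall>r. s r \<le> e r"
    using assms unfolding skew_tab_def by (elim conjE)
  then show "s r \<le> e r" ..
  show "dom T = {(r, c). s r \<le> c \<and> c < e r} - H"
    using assms unfolding skew_tab_def by (elim conjE)
  have "\<forall>r c c' x y. c < c' \<longrightarrow> T (r, c) = Some x \<longrightarrow> T (r, c') = Some y \<longrightarrow> x < y"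
    using assms unfolding skew_tab_def by (elim conjE)
  then show "c < c' \<Longrightarrow> T (r, c) = Some x \<Longrightarrow> T (r, c') = Some y \<Longrightarrow> x < y" by blast
  have "\<forall>r r' c x y. r < r' \<longrightarrow> T (r, c) = Some x \<longrightarrow> T (r', c) = Some y \<longrightarrow> x < y"
    using assms unfolding skew_tab_def by (elim conjE)
  then show "r < r' \<Longrightarrow> T (r, c) = Some x \<Longrightarrow> T (r', c) = Some y \<Longrightarrow> x < y" by blast
  have "\<forall>p p' x. T p = Some x \<longrightarrow> T p' = Some x \<longrightarrow> p = p'"
    using assms unfolding skew_tab_def by (elim conjE)
  then show "T p = Some x \<Longrightarrow> T p' = Some x \<Longrightarrow> p = p'" by blast
qed

lemma skew_SomeD:
  assumes "skew_tab s e H T" "T (r, c) = Some x"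
  shows "s r \<le> c" "c < e r" "(r, c) \<notin> H"
proof -
  have "(r, c) \<in> dom T" using assms(2) by blast
  then have "(r, c) \<in> {(r, c). s r \<le> c \<and> c < e r} - H" by (simp only: skew_dom[OF assms(1)])
  then show "s r \<le> c" "c < e r" "(r, c) \<notin> H" by auto
qed

lemma skew_filled:
  assumes "skew_tab s e H T" "s r \<le> c" "c < e r" "(r, c) \<notin> H"
  obtains x where "T (r, c) = Some x"
proof -
  have "(r, c) \<in> {(r, c). s r \<le> c \<and> c < e r} - H" using assms(2-4) by simp
  then have "(r, c) \<in> dom T" by (simp only: skew_dom[OF assms(1)])
  then show ?thesis using that by blast
qed

text \<open>Exchanging a hole with a filled cell can only endanger the row and column orders; shape
  and injectivity are settled here once for both kinds of move.\<close>

lemma skew_tab_move: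
  assumes sk: "skew_tab s e {p} T" and p: "s (fst p) \<le> snd p" "snd p < e (fst p)"
    and x: "T p' = Some x"
    and row: "\<And>r c c' y z. c < c' \<Longrightarrow> (T(p := Some x, p' := None)) (r, c) = Some y \<Longrightarrow>
      (T(p := Some x, p' := None)) (r, c') = Some z \<Longrightarrow> y < z"
    and col: "\<And>r r' c y z. r < r' \<Longrightarrow> (T(p := Some x, p' := None)) (r, c) = Some y \<Longrightarrow>
      (T(p := Some x, p' := None)) (r', c) = Some z \<Longrightarrow> y < z"
  shows "skew_tab s e {p'} (T(p := Some x, p' := None))" (is "skew_tab _ _ _ ?T")
  unfolding skew_tab_def
proof (intro conjI)
  show "antimono s"
    using sk unfolding skew_tab_def by (elim conjE)
  show "antimono e"
    using sk unfolding skew_tab_def by (elim conjE)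
  show "\<forall>r. s r \<le> e r"
    using sk unfolding skew_tab_def by (elim conjE)
  have "p' \<in> dom T" using x by blast
  moreover have "dom ?T = insert p (dom T) - {p'}" by auto
  ultimately show "dom ?T = {(r, c). s r \<le> c \<and> c < e r} - {p'}"
    using p unfolding skew_dom[OF sk] by (cases p) auto
  show "\<forall>r c c' y z. c < c' \<longrightarrow> ?T (r, c) = Some y \<longrightarrow> ?T (r, c') = Some z \<longrightarrow> y < z"
    using row by blast
  show "\<forall>r r' c y z. r < r' \<longrightarrow> ?T (r, c) = Some y \<longrightarrow> ?T (r', c) = Some z \<longrightarrow> y < z"
    using col by blast
  show "\<forall>q q' y. ?T q = Some y \<longrightarrow> ?T q' = Some y \<longrightarrow> q = q'"
  proof (intro allI impI)
    fix q q' y assume "?T q = Some y" "?T q' = Some y"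
    then have "T (if q = p then p' else q) = Some y" "T (if q' = p then p' else q') = Some y"
      and "q \<noteq> p'" "q' \<noteq> p'"
      using x by (auto split: if_splits)
    from skew_inj[OF sk this(1,2)] this(3,4) show "q = q'" by (auto split: if_splits)
  qed
qed

lemma skew_right_move:
  assumes sk: "skew_tab s e {(h, j)} T" and j: "s h \<le> j" "j < e h"
    and x: "T (h, Suc j) = Some x"
    and below: "\<forall>a. T (Suc h, j) = Some a \<longrightarrow> \<not> a < x"
  shows "skew_tab s e {(h, Suc j)} (T((h, j) := Some x, (h, Suc j) := None))" (is "skew_tab _ _ _ ?T")
    and "Suc j < e h"
    and "rowset (T((h, j) := Some x, (h, Suc j) := None)) = rowset T"
proof -
  show j': "Suc j < e h" using skew_SomeD[OF sk x] by simp
  have hole: "T (h, j) = None" using skew_SomeD[OF sk, of h j] by (cases "T (h, j)") auto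
  have above_lt: "v < x" if "r < h" "T (r, j) = Some v" for r v
  proof -
    have "s r \<le> j" using skew_SomeD[OF sk that(2)] by simp
    moreover have "Suc j < e r" using j' skew_antimono_e[OF sk, of r h] that by simp
    ultimately obtain u where u: "T (r, Suc j) = Some u"
      using skew_filled[OF sk, of r "Suc j"] that(1) by auto
    have "v < u" using skew_row[OF sk _ that(2) u] by simp
    also have "u < x" using skew_col[OF sk that(1) u x] .
    finally show ?thesis .
  qed
  have below_gt: "x < v" if "h < r" "T (r, j) = Some v" for r v
  proof -
    have "s (Suc h) \<le> j" using j skew_antimono_s[OF sk, of h "Suc h"] by simp
    moreover have "j < e (Suc h)"
      using skew_SomeD[OF sk that(2)] skew_antimono_e[OF sk, of "Suc h" r] that by simp
    ultimately obtain a where a: "T (Suc h, j) = Some a"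
      using skew_filled[OF sk, of "Suc h" j] by auto
    have "a \<noteq> x" using skew_inj[OF sk a, of "(h, Suc j)"] x by auto
    with below a have "x < a" by simp
    also have "a \<le> v" using skew_col[OF sk _ a that(2)] a that by (cases "r = Suc h") auto
    finally show ?thesis .
  qed
  have left: "v < x" if "c < j" "T (h, c) = Some v" for c v
    using skew_row[OF sk _ that(2) x] that by simp
  have right: "x < v" if "Suc j < c" "T (h, c) = Some v" for c v
    using skew_row[OF sk that(1) x that(2)] .
  show "skew_tab s e {(h, Suc j)} ?T"
  proof (rule skew_tab_move[OF sk _ _ x])
    show "y < z" if "c < c'" "?T (r, c) = Some y" "?T (r, c') = Some z" for r c c' y z
      using that left right skew_row[OF sk that(1), of r]
      by (auto split: if_splits) (metis Suc_lessI)
    show "y < z" if "r < r'" "?T (r, c) = Some y" "?T (r', c) = Some z" for r r' c y z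
      using that above_lt below_gt skew_col[OF sk that(1), of c] by (auto split: if_splits)
  qed (use j in simp_all)
  show "rowset ?T = rowset T"
  proof (rule ext)
    fix r show "rowset ?T r = rowset T r"
      using x hole unfolding rowset_def by (auto split: if_splits) (metis option.distinct(1) option.inject n_not_Suc_n)+
  qed
qed

text \<open>The last two claims recover \<open>a\<close> from the row sets alone, as the least value
  at which the lower count exceeds the upper one by more than \<open>s h - s (Suc h)\<close>. Below
  \<open>a\<close>, each entry of the lower row lies left of the hole, either in the
  \<open>s (Suc h)..<s h\<close> overhang or under a smaller entry of row \<open>h\<close>.\<close>

lemma skew_down_move:
  assumes sk: "skew_tab s e {(h, j)} T" and j: "s h \<le> j" "j < e h"
    and a: "T (Suc h, j) = Some a"
    and right: "\<forall>c. T (h, Suc j) = Some c \<longrightarrow> a < c"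
  shows "skew_tab s e {(Suc h, j)} (T((h, j) := Some a, (Suc h, j) := None))" (is "skew_tab _ _ _ ?T")
    and "s (Suc h) \<le> j" and "j < e (Suc h)"
    and "rowset (T((h, j) := Some a, (Suc h, j) := None)) =
      (rowset T)(h := insert a (rowset T h), Suc h := rowset T (Suc h) - {a})"
    and "a \<in> rowset T (Suc h)" and "a \<notin> rowset T h"
    and "x < a \<Longrightarrow> cnt (rowset T (Suc h)) x + s (Suc h) \<le> cnt (rowset T h) x + s h"
    and "cnt (rowset T (Suc h)) a + s (Suc h) = cnt (rowset T h) a + s h + 1"
proof -
  show j': "s (Suc h) \<le> j" "j < e (Suc h)" using skew_SomeD[OF sk a] by auto
  have hole: "T (h, j) = None" using skew_SomeD[OF sk, of h j] by (cases "T (h, j)") auto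
  have above_lt: "v < a" if "r < h" "T (r, j) = Some v" for r v
    using skew_col[OF sk _ that(2) a] that by simp
  have below_gt: "a < v" if "Suc h < r" "T (r, j) = Some v" for r v
    using skew_col[OF sk _ a that(2)] that by simp
  have left: "v < a" if "c < j" "T (h, c) = Some v" for c v
  proof -
    have "s (Suc h) \<le> c" "c < e (Suc h)"
      using skew_SomeD[OF sk that(2)] skew_antimono_s[OF sk, of h "Suc h"] j' that(1) by simp_all
    then obtain u where u: "T (Suc h, c) = Some u"
      using skew_filled[OF sk, of "Suc h" c] \<open>c < j\<close> by auto
    have "v < u" using skew_col[OF sk _ that(2) u] by simp
    also have "u < a" using skew_row[OF sk that(1) u a] .
    finally show ?thesis .
  qed
  have right': "a < v" if "j < c" "T (h, c) = Some v" for c v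
  proof -
    have "s h \<le> Suc j" "Suc j < e h" using skew_SomeD[OF sk that(2)] that(1) j by auto
    then obtain u where u: "T (h, Suc j) = Some u"
      using skew_filled[OF sk, of h "Suc j"] by auto
    then have "u \<le> v"
      using skew_row[OF sk _ u that(2)] that by (cases "c = Suc j") auto
    with right u show ?thesis by simp
  qed
  show "skew_tab s e {(Suc h, j)} ?T"
  proof (rule skew_tab_move[OF sk _ _ a])
    show "y < z" if "c < c'" "?T (r, c) = Some y" "?T (r, c') = Some z" for r c c' y z
      using that left right' skew_row[OF sk that(1), of r] by (auto split: if_splits)
    show "y < z" if "r < r'" "?T (r, c) = Some y" "?T (r', c) = Some z" for r r' c y z
      using that above_lt below_gt skew_col[OF sk that(1), of c]
      by (auto split: if_splits) (metis Suc_lessI)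
  qed (use j in simp_all)
  show "rowset ?T = (rowset T)(h := insert a (rowset T h), Suc h := rowset T (Suc h) - {a})"
  proof (rule ext)
    fix r
    show "rowset ?T r = ((rowset T)(h := insert a (rowset T h), Suc h := rowset T (Suc h) - {a})) r"
    proof (cases "r = h \<or> r = Suc h")
      case False
      then show ?thesis by (auto simp: rowset_def)
    next
      case True
      then show ?thesis
      proof
        assume "r = h"
        then show ?thesis using hole by (auto simp: rowset_def split: if_splits) (metis option.distinct(1))
      next
        assume "r = Suc h"
        have "c = j" if "T (Suc h, c) = Some a" for c
          using skew_inj[OF sk that a] by simp
        with a have "(\<exists>c. c \<noteq> j \<and> T (Suc h, c) = Some y) \<longleftrightarrow> (\<exists>c. T (Suc h, c) = Some y) \<and> y \<noteq> a" for y
          by (metis option.inject)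
        moreover have "rowset ?T (Suc h) = {y. \<exists>c. c \<noteq> j \<and> T (Suc h, c) = Some y}"
          by (auto simp: rowset_def)
        ultimately show ?thesis using \<open>r = Suc h\<close> by (auto simp: rowset_def)
      qed
    qed
  qed
  show "a \<in> rowset T (Suc h)" using a by (auto simp: rowset_def)
  show "a \<notin> rowset T h" using skew_inj[OF sk a] by (fastforce simp: rowset_def)
  have cols: "cnt (rowset T r) x = card {c. \<exists>y \<le> x. T (r, c) = Some y}" for r x
    by (rule cnt_eq_card_columns) (use skew_inj[OF sk] in blast)
  have le: "s (Suc h) \<le> s h" using skew_antimono_s[OF sk] by simp
  {
    assume "x < a"
    have sub: "{c. \<exists>y \<le> x. T (Suc h, c) = Some y} \<subseteq>
        {s (Suc h)..<s h} \<union> {c. \<exists>y \<le> x. T (h, c) = Some y}"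
    proof
      fix c assume "c \<in> {c. \<exists>y \<le> x. T (Suc h, c) = Some y}"
      then obtain y where *: "y \<le> x" "T (Suc h, c) = Some y" by blast
      have "c < j"
      proof (rule ccontr)
        assume "\<not> c < j"
        then have "a \<le> y" using skew_row[OF sk _ a *(2)] a *(2) by (cases "c = j") auto
        with * \<open>x < a\<close> show False by simp
      qed
      show "c \<in> {s (Suc h)..<s h} \<union> {c. \<exists>y \<le> x. T (h, c) = Some y}"
      proof (cases "c < s h")
        case True
        then show ?thesis using skew_SomeD[OF sk *(2)] by simp
      next
        case False
        then obtain u where u: "T (h, c) = Some u"
          using skew_filled[OF sk, of h c] \<open>c < j\<close> j by auto
        then have "u < y" using skew_col[OF sk _ u *(2)] by simp
        with *(1) have "u \<le> x" by simp
        with u show ?thesis by auto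
      qed
    qed
    have fin: "finite {c. \<exists>y \<le> x. T (h, c) = Some y}"
      by (rule finite_subset[of _ "{..<e h}"]) (use skew_SomeD[OF sk] in auto)
    have "card {c. \<exists>y \<le> x. T (Suc h, c) = Some y} \<le>
        card {s (Suc h)..<s h} + card {c. \<exists>y \<le> x. T (h, c) = Some y}"
      using card_mono[OF _ sub] fin card_Un_le order_trans by blast
    then show "cnt (rowset T (Suc h)) x + s (Suc h) \<le> cnt (rowset T h) x + s h"
      using le by (simp add: cols)
  }
  \<comment> \<open>At \<open>a\<close> the bound is exceeded by exactly one: the lower row
    contributes all columns up to \<open>j\<close>, the upper row only those before the hole in
    column \<open>j\<close>.\<close>
  have "{c. \<exists>y \<le> a. T (Suc h, c) = Some y} = {s (Suc h)..j}"
  proof (rule set_eqI, rule iffI)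
    fix c assume "c \<in> {c. \<exists>y \<le> a. T (Suc h, c) = Some y}"
    then obtain y where y: "y \<le> a" "T (Suc h, c) = Some y" by auto
    then have "\<not> j < c" using skew_row[OF sk _ a y(2)] by auto
    then show "c \<in> {s (Suc h)..j}" using skew_SomeD[OF sk y(2)] by simp
  next
    fix c assume c: "c \<in> {s (Suc h)..j}"
    then obtain y where y: "T (Suc h, c) = Some y"
      using skew_filled[OF sk, of "Suc h" c] j' by auto
    have "y \<le> a" using skew_row[OF sk _ y a] c y a by (cases "c = j") auto
    with y show "c \<in> {c. \<exists>y \<le> a. T (Suc h, c) = Some y}" by auto
  qed
  moreover have "{c. \<exists>y \<le> a. T (h, c) = Some y} = {s h..<j}"
  proof (rule set_eqI, rule iffI)
    fix c assume "c \<in> {c. \<exists>y \<le> a. T (h, c) = Some y}"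
    then obtain y where y: "y \<le> a" "T (h, c) = Some y" by auto
    then have "c < j" using right'[OF _ y(2)] hole by (metis linorder_neqE_nat not_le option.distinct(1))
    then show "c \<in> {s h..<j}" using skew_SomeD[OF sk y(2)] by simp
  next
    fix c assume c: "c \<in> {s h..<j}"
    then obtain y where y: "T (h, c) = Some y"
      using skew_filled[OF sk, of h c] j by auto
    then show "c \<in> {c. \<exists>y \<le> a. T (h, c) = Some y}" using left[OF _ y] c by auto
  qed
  ultimately show "cnt (rowset T (Suc h)) a + s (Suc h) = cnt (rowset T h) a + s h + 1"
    using j j' by (simp add: cols)
qed

section \<open>Invariants along a slide\<close>

text \<open>The fuel is at least the number of filled cells weakly south-east of the hole, and each
  move lowers that number. Hence the fuel can be exhausted only when both neighbours of the hole are
  empty, which is how every slide ends.\<close>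

lemma slide_invariant:
  assumes right: "\<And>T h j x. Inv T (h, j) \<Longrightarrow> T (h, Suc j) = Some x \<Longrightarrow>
      (\<And>a. T (Suc h, j) = Some a \<Longrightarrow> \<not> a < x) \<Longrightarrow>
      Inv (T((h, j) := Some x, (h, Suc j) := None)) (h, Suc j)"
    and down: "\<And>T h j a. Inv T (h, j) \<Longrightarrow> T (Suc h, j) = Some a \<Longrightarrow>
      (\<And>c. T (h, Suc j) = Some c \<Longrightarrow> a < c) \<Longrightarrow>
      Inv (T((h, j) := Some a, (Suc h, j) := None)) (Suc h, j)"
    and "Inv T (h, j)" and "finite (dom T)"
    and "card {p \<in> dom T. h \<le> fst p \<and> j \<le> snd p} \<le> n"
  shows "\<exists>h' j'. Inv (slide n T (h, j)) (h', j') \<and>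
      slide n T (h, j) (Suc h', j') = None \<and> slide n T (h, j) (h', Suc j') = None"
  using assms(3-5)
proof (induction n arbitrary: T h j)
  case 0
  then have "{p \<in> dom T. h \<le> fst p \<and> j \<le> snd p} = {}" by simp
  then have "(Suc h, j) \<notin> dom T \<and> (h, Suc j) \<notin> dom T" by fastforce
  then have "T (Suc h, j) = None \<and> T (h, Suc j) = None" by auto
  with 0 show ?case by auto
next
  case (Suc n)
  let ?SE = "\<lambda>T h j. {p \<in> dom T. h \<le> fst p \<and> j \<le> snd p}"
  have fin: "finite (?SE T h j)" using Suc.prems by simp
  have R: "\<exists>h' j'. Inv (slide n U (h, Suc j)) (h', j') \<and>
      slide n U (h, Suc j) (Suc h', j') = None \<and> slide n U (h, Suc j) (h', Suc j') = None"
    if x: "T (h, Suc j) = Some x" and b: "\<And>a. T (Suc h, j) = Some a \<Longrightarrow> \<not> a < x"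
      and T: "U = T((h, j) := Some x, (h, Suc j) := None)" for x U
  proof (rule Suc.IH)
    show "Inv U (h, Suc j)" using right[OF Suc.prems(1) x b] T by simp
    show "finite (dom U)" using Suc.prems T by simp
    have "?SE U h (Suc j) \<subseteq> ?SE T h j - {(h, Suc j)}" using T by auto
    with fin have "card (?SE U h (Suc j)) \<le> card (?SE T h j - {(h, Suc j)})" by (simp add: card_mono)
    also have "\<dots> < card (?SE T h j)" using x fin by (intro card_Diff1_less) auto
    finally show "card (?SE U h (Suc j)) \<le> n" using Suc.prems by simp
  qed
  have D: "\<exists>h' j'. Inv (slide n U (Suc h, j)) (h', j') \<and>
      slide n U (Suc h, j) (Suc h', j') = None \<and> slide n U (Suc h, j) (h', Suc j') = None"
    if x: "T (Suc h, j) = Some x" and b: "\<And>c. T (h, Suc j) = Some c \<Longrightarrow> x < c"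
      and T: "U = T((h, j) := Some x, (Suc h, j) := None)" for x U
  proof (rule Suc.IH)
    show "Inv U (Suc h, j)" using down[OF Suc.prems(1) x b] T by simp
    show "finite (dom U)" using Suc.prems T by simp
    have "?SE U (Suc h) j \<subseteq> ?SE T h j - {(Suc h, j)}" using T by auto
    with fin have "card (?SE U (Suc h) j) \<le> card (?SE T h j - {(Suc h, j)})" by (simp add: card_mono)
    also have "\<dots> < card (?SE T h j)" using x fin by (intro card_Diff1_less) auto
    finally show "card (?SE U (Suc h) j) \<le> n" using Suc.prems by simp
  qed
  show ?case
  proof (cases "T (Suc h, j)")
    case None
    then show ?thesis
    proof (cases "T (h, Suc j)")
      case (Some c)
      then show ?thesis using R[OF Some _ refl] None by simp
    qed (use None Suc.prems in auto)
  next
    case (Some a)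
    show ?thesis
    proof (cases "T (h, Suc j)")
      case None
      then show ?thesis using D[OF Some _ refl] Some by simp
    next
      case (Some c)
      then show ?thesis using R[OF Some _ refl] D[OF \<open>T (Suc h, j) = Some a\<close> _ refl]
          \<open>T (Suc h, j) = Some a\<close> by simp
    qed
  qed
qed

section \<open>Bookkeeping of the exchanged entries\<close>

text \<open>Blocks that changes between rows \<open>q\<close> and \<open>q + 1\<close> can reach by the end of phase \<open>i\<close>; the
  minimum only matters for the bottom row \<open>q = b - 1\<close>.\<close>
definition reach :: "nat \<Rightarrow> nat \<Rightarrow> nat \<Rightarrow> nat" where
  "reach b i q = min (b - 1 - i + (q - i)) (2 * b - 3)"

text \<open>\<open>R0\<close> stands for the rows of the power before any slide and \<open>N\<close>
  for a bound on its entries. Periodicity and decreasing row lengths enter the bookkeeping as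
  \<open>window\<close>: over \<open>m\<close> consecutive values the lower count gains no more than
  the upper one.\<close>

locale periodic_rows =
  fixes b m N :: nat and R0 :: "nat \<Rightarrow> nat set"
  assumes b_ge_2: "2 \<le> b" and m_pos: "0 < m"
    and window: "Suc q < b \<Longrightarrow> x + m \<le> N \<Longrightarrow>
      cnt (R0 (Suc q)) (x + m) + cnt (R0 q) x \<le> cnt (R0 (Suc q)) x + cnt (R0 q) (x + m)"
begin

text \<open>The condition on a pair of rows \<open>q\<close>, \<open>q + 1\<close> that has not exchanged an entry in this phase.\<close>
definition fresh :: "nat \<Rightarrow> nat \<Rightarrow> (nat \<Rightarrow> nat set) \<Rightarrow> bool" where
  "fresh i q R \<longleftrightarrow> (\<forall>x. reach b i q * m < x \<longrightarrow> x \<le> N \<longrightarrow>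
     cnt (R (Suc q)) x + cnt (R q) (x - m) \<le> cnt (R (Suc q)) (x - m) + cnt (R q) x)"

text \<open>The condition on a pair whose last exchanged entry in this phase is \<open>a\<close>: the counts up to
  \<open>a - 1\<close> stay \<open>d\<close> apart, which forces the next exchanged entry to be smaller.\<close>
definition used :: "nat \<Rightarrow> nat \<Rightarrow> nat \<Rightarrow> nat \<Rightarrow> (nat \<Rightarrow> nat set) \<Rightarrow> bool" where
  "used i d q a R \<longleftrightarrow> 0 < a \<and> a \<le> reach b i q * m \<and>
     cnt (R q) (a - 1) + d \<le> cnt (R (Suc q)) (a - 1)"

text \<open>\<open>A q\<close> is the entry last moved from row \<open>q + 1\<close> to row \<open>q\<close> in phase \<open>i\<close>, if any, and \<open>h\<close> the
  row of the hole, with \<open>h = b\<close> between slides.  The arrival of the hole in row \<open>h\<close> removed an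
  entry of that row or lowered \<open>s h\<close>, hence the extra 1 in that row.\<close>
definition book :: "nat \<Rightarrow> (nat \<Rightarrow> nat) \<Rightarrow> nat \<Rightarrow> (nat \<Rightarrow> nat option) \<Rightarrow> (nat \<Rightarrow> nat set) \<Rightarrow> bool" where
  "book i s h A R \<longleftrightarrow>
     (\<forall>q. i \<le> q \<longrightarrow> Suc q < b \<longrightarrow> A q = None \<longrightarrow> fresh i q R) \<and>
     (\<forall>q a. i \<le> q \<longrightarrow> Suc q < b \<longrightarrow> A q = Some a \<longrightarrow> used i (s q + (if q = h then 1 else 0)) q a R) \<and>
     (\<forall>q. i \<le> q \<longrightarrow> A q = None \<longrightarrow> A (Suc q) = None) \<and>
     (\<forall>q a a'. i \<le> q \<longrightarrow> A q = Some a \<longrightarrow> A (Suc q) = Some a' \<longrightarrow> a < a') \<and>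
     (\<forall>r x. i \<le> r \<longrightarrow> reach b i r * m < x \<longrightarrow> (x \<in> R r \<longleftrightarrow> x \<in> R0 r)) \<and>
     (\<forall>r<i. R r = R0 r) \<and> (\<forall>r. R r \<subseteq> {1..N})"

lemma
  assumes "book i s h A R"
  shows book_fresh: "i \<le> q \<Longrightarrow> Suc q < b \<Longrightarrow> A q = None \<Longrightarrow> fresh i q R"
    and book_used: "i \<le> q \<Longrightarrow> Suc q < b \<Longrightarrow> A q = Some a \<Longrightarrow>
      used i (s q + (if q = h then 1 else 0)) q a R"
    and book_prefix: "i \<le> q \<Longrightarrow> A q = None \<Longrightarrow> A (Suc q) = None"
    and book_increasing: "i \<le> q \<Longrightarrow> A q = Some a \<Longrightarrow> A (Suc q) = Some a' \<Longrightarrow> a < a'"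
    and book_tail: "i \<le> r \<Longrightarrow> reach b i r * m < x \<Longrightarrow> x \<in> R r \<longleftrightarrow> x \<in> R0 r"
    and book_upper: "r < i \<Longrightarrow> R r = R0 r"
    and book_range: "R r \<subseteq> {1..N}"
  using assms unfolding book_def by blast+

text \<open>\<open>used\<close> becomes weaker as its gap \<open>d\<close> drops. This serves both
  ends of a slide: at its start \<open>s i\<close> gives up one unit, which pays for the extra 1 of
  the hole in row \<open>i\<close>; at its end the extra 1 is dropped.\<close>

lemma book_weaken:
  assumes "book i s h A R"
    and "\<And>q. i \<le> q \<Longrightarrow> Suc q < b \<Longrightarrow>
      s' q + (if q = h' then 1 else 0) \<le> s q + (if q = h then 1 else 0)"
  shows "book i s' h' A R"
proof -
  have "used i (s' q + (if q = h' then 1 else 0)) q a R"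
    if "i \<le> q" "Suc q < b" "A q = Some a" for q a
    using book_used[OF assms(1) that] assms(2)[OF that(1,2)] unfolding used_def by linarith
  then show ?thesis using assms(1) unfolding book_def by blast
qed

text \<open>For \<open>i = b - 1\<close> there is no pair of rows at or below row \<open>i\<close>,
  so \<open>fresh\<close> and \<open>used\<close> are demanded of nothing.\<close>

lemma book_first_phase:
  assumes "\<And>r. R0 r \<subseteq> {1..N}"
  shows "book (b - 1) s h (\<lambda>_. None) R0"
  using assms unfolding book_def by auto

text \<open>A new phase forgets the exchanges of the previous one. Those have altered rows
  \<open>q\<close> and \<open>Suc q\<close> only up to one block before \<open>reach b i q\<close>,
  and row \<open>i\<close> not at all, so the original window inequality holds for every window
  ending beyond \<open>reach b i q * m\<close>.\<close>

lemma book_next_phase: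
  assumes bk: "book (Suc i) s h A R" and i: "Suc i < b"
  shows "book i s' h' (\<lambda>_. None) R"
proof -
  have tail: "x \<in> R r \<longleftrightarrow> x \<in> R0 r" if "(reach b i r - 1) * m < x" "i \<le> r" "Suc r < b" for r x
  proof (cases "r = i")
    case True
    then show ?thesis using book_upper[OF bk, of r] by simp
  next
    case False
    have "reach b (Suc i) r \<le> reach b i r - 1"
      using False that i by (auto simp: reach_def)
    then have "reach b (Suc i) r * m < x" using that(1) mult_le_mono1 le_less_trans by blast
    then show ?thesis using book_tail[OF bk, of r x] False that(2) by simp
  qed
  \<comment> \<open>For a fixed row below row \<open>i\<close> the next phase number lowers
    \<open>reach\<close> by two, and passing to the next row gives one back. Row
    \<open>Suc r\<close> is thus the one that fixes the loss at a single block.\<close>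
  have tail_Suc: "x \<in> R (Suc r) \<longleftrightarrow> x \<in> R0 (Suc r)"
    if "(reach b i r - 1) * m < x" "i \<le> r" "Suc r < b" for r x
  proof -
    have "reach b (Suc i) (Suc r) \<le> reach b i r - 1"
      using that i by (auto simp: reach_def)
    then have "reach b (Suc i) (Suc r) * m < x" using that(1) mult_le_mono1 le_less_trans by blast
    then show ?thesis using book_tail[OF bk, of "Suc r" x] that(2) by simp
  qed
  have "fresh i q R" if q: "i \<le> q" "Suc q < b" for q
    unfolding fresh_def
  proof (intro allI impI)
    fix x assume x: "reach b i q * m < x" "x \<le> N"
    \<comment> \<open>A positive \<open>reach\<close> gives \<open>m < x\<close>, so
      \<open>x - m\<close> is not truncated.\<close>
    have "1 \<le> reach b i q" using q by (auto simp: reach_def)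
    then have "reach b i q * m = (reach b i q - 1) * m + m"
      by (cases "reach b i q") simp_all
    define y where "y = x - m"
    with x \<open>reach b i q * m = _\<close> have y: "x = y + m" "(reach b i q - 1) * m \<le> y"
      by linarith+
    have "cnt (R q) (y + m) + cnt (R0 q) y = cnt (R q) y + cnt (R0 q) (y + m)"
      by (rule cnt_agree_above) (use tail q y in auto)
    moreover have "cnt (R (Suc q)) (y + m) + cnt (R0 (Suc q)) y =
        cnt (R (Suc q)) y + cnt (R0 (Suc q)) (y + m)"
      by (rule cnt_agree_above) (use tail_Suc q y in auto)
    moreover have "cnt (R0 (Suc q)) (y + m) + cnt (R0 q) y \<le>
        cnt (R0 (Suc q)) y + cnt (R0 q) (y + m)"
      using window q x y by simp
    ultimately show "cnt (R (Suc q)) x + cnt (R q) (x - m) \<le>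
        cnt (R (Suc q)) (x - m) + cnt (R q) x"
      using y by simp
  qed
  moreover have "x \<in> R r \<longleftrightarrow> x \<in> R0 r" if "i \<le> r" "reach b i r * m < x" for r x
  proof (cases "r = i")
    case True
    then show ?thesis using book_upper[OF bk, of r] by simp
  next
    case False
    have "reach b (Suc i) r \<le> reach b i r" by (auto simp: reach_def)
    then have "reach b (Suc i) r * m < x" using that(2) mult_le_mono1 le_less_trans by blast
    then show ?thesis using book_tail[OF bk, of r x] False that(1) by simp
  qed
  moreover have "\<forall>r<i. R r = R0 r" using book_upper[OF bk] by simp
  moreover have "\<forall>r. R r \<subseteq> {1..N}" using book_range[OF bk] by simp
  ultimately show ?thesis unfolding book_def by simp
qed

text \<open>By \<open>before\<close> and \<open>at\<close>, the gap between the counts of rows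
  \<open>Suc h\<close> and \<open>h\<close> exceeds \<open>s h\<close> at \<open>a\<close> for the
  first time. A recorded exchange of this pair forces \<open>a\<close> below the recorded entry, and
  without one \<open>fresh\<close> confines \<open>a\<close>. The condition \<open>above\<close>
  keeps the exchanged entries increasing from row to row.\<close>

lemma book_down:
  assumes bk: "book i s h A R" and h: "i \<le> h" "Suc h < b"
    and a: "a \<in> R (Suc h)" "a \<notin> R h"
    and before: "\<And>x. x < a \<Longrightarrow> cnt (R (Suc h)) x \<le> cnt (R h) x + s h"
    and at: "cnt (R (Suc h)) a = cnt (R h) a + s h + 1"
    and above: "i < h \<Longrightarrow> \<exists>z. A (h - 1) = Some z \<and> z < a"
    and s0: "s (Suc h) = 0"
  shows "book i s (Suc h) (A(h := Some a)) (R(h := insert a (R h), Suc h := R (Suc h) - {a}))"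
    (is "book _ _ _ ?A ?R")
proof -
  have aN: "0 < a" "a \<le> N" using a book_range[OF bk, of "Suc h"] by auto
  \<comment> \<open>At \<open>a' - 1\<close> the recorded gap is already \<open>s h + 1\<close>,
    because the hole stands in row \<open>h\<close>; at values below \<open>a\<close> it is at most
    \<open>s h\<close>.\<close>
  have old: "a < a'" if "A h = Some a'" for a'
  proof (rule ccontr)
    assume "\<not> a < a'"
    moreover have u: "used i (s h + 1) h a' R" using book_used[OF bk h that] by simp
    ultimately have "a' - 1 < a" by (auto simp: used_def)
    from before[OF this] u show False by (simp add: used_def)
  qed
  have a_le: "a \<le> reach b i h * m"
  proof (cases "A h")
    case None
    \<comment> \<open>Otherwise \<open>fresh\<close> bounds the gap at \<open>a\<close> by the gap
      at \<open>a - m\<close>, which is at most \<open>s h\<close> by \<open>before\<close>, whereas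
      \<open>at\<close> gives \<open>s h + 1\<close>.\<close>
    show ?thesis
    proof (rule ccontr)
      assume "\<not> ?thesis"
      with book_fresh[OF bk h None] aN
      have "cnt (R (Suc h)) a + cnt (R h) (a - m) \<le> cnt (R (Suc h)) (a - m) + cnt (R h) a"
        by (simp add: fresh_def)
      moreover have "cnt (R (Suc h)) (a - m) \<le> cnt (R h) (a - m) + s h"
        by (rule before) (use aN m_pos in simp)
      ultimately show False using at by simp
    qed
  next
    case (Some a')
    then show ?thesis using old[OF Some] book_used[OF bk h Some] by (simp add: used_def)
  qed
  have cnt_h: "cnt (?R h) x = cnt (R h) x + (if a \<le> x then 1 else 0)" for x
    using cnt_insert[OF a(2)] by simp
  have cnt_Suc_h: "cnt (?R (Suc h)) x + (if a \<le> x then 1 else 0) = cnt (R (Suc h)) x" for x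
    using cnt_remove[OF a(1)] by simp
  have R_other: "?R q = R q" if "q \<noteq> h" "q \<noteq> Suc h" for q using that by simp
  have reach_Suc: "reach b i (Suc h) = reach b i h + 1" if "Suc (Suc h) < b"
    using that h by (auto simp: reach_def)
  have reach_mono: "reach b i h * m \<le> reach b i (Suc h) * m"
    by (rule mult_le_mono1) (auto simp: reach_def)
  have fresh': "fresh i q ?R" if q: "i \<le> q" "Suc q < b" "?A q = None" for q
  proof -
    have "q \<noteq> h" and Aq: "A q = None" using q(3) by (auto split: if_splits)
    \<comment> \<open>The pair just above the hole has a recorded exchange by \<open>above\<close>,
      so it cannot be the fresh pair \<open>q\<close>.\<close>
    have "Suc q \<noteq> h" using above Aq q(1) by auto
    note fr = book_fresh[OF bk q(1,2) Aq]
    show ?thesis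
    proof (cases "q = Suc h")
      case True
      show ?thesis unfolding fresh_def
      proof (intro allI impI)
        fix x assume x: "reach b i q * m < x" "x \<le> N"
        \<comment> \<open>The extra block of \<open>reach\<close> in row \<open>Suc h\<close> puts
          \<open>a\<close> before the whole window, so its removal lowers the counts at both ends
          alike.\<close>
        have "reach b i h * m + m < x" using x True q(2) reach_Suc by simp
        with a_le have "a \<le> x - m" "a \<le> x" by simp_all
        then have "cnt (?R q) x + 1 = cnt (R q) x" "cnt (?R q) (x - m) + 1 = cnt (R q) (x - m)"
          using cnt_Suc_h[of x] cnt_Suc_h[of "x - m"] True by simp_all
        moreover have "cnt (?R (Suc q)) y = cnt (R (Suc q)) y" for y
          using R_other[of "Suc q"] True by simp
        note this[of x] this[of "x - m"]
        moreover have "cnt (R (Suc q)) x + cnt (R q) (x - m) \<le> cnt (R (Suc q)) (x - m) + cnt (R q) x"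
          using fr x unfolding fresh_def by blast
        ultimately show "cnt (?R (Suc q)) x + cnt (?R q) (x - m) \<le>
            cnt (?R (Suc q)) (x - m) + cnt (?R q) x"
          by linarith
      qed
    next
      case False
      then show ?thesis using fr \<open>q \<noteq> h\<close> \<open>Suc q \<noteq> h\<close> by (simp add: fresh_def)
    qed
  qed
  have used': "used i (s q + (if q = Suc h then 1 else 0)) q a' ?R"
    if q: "i \<le> q" "Suc q < b" "?A q = Some a'" for q a'
  proof -
    consider "q = h" | "q = Suc h" | "Suc q = h" | "q \<noteq> h" "q \<noteq> Suc h" "Suc q \<noteq> h" by blast
    then show ?thesis
    proof cases
      case 1
      then have "a' = a" using q by simp
      obtain a1 where a1: "a = Suc a1" using aN by (cases a) auto
      \<comment> \<open>Since \<open>a\<close> belongs to the lower row only, the gap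
        \<open>s h + 1\<close> at \<open>a\<close> means a gap \<open>s h\<close> at
        \<open>a - 1\<close>, where the exchange does not affect the counts.\<close>
      have "cnt (R (Suc h)) a = cnt (R (Suc h)) a1 + 1" "cnt (R h) a = cnt (R h) a1"
        using a a1 cnt_Suc by simp_all
      then show ?thesis using 1 \<open>a' = a\<close> a_le aN at a1 cnt_h[of a1] cnt_Suc_h[of a1]
        by (simp add: used_def)
    next
      case 2
      then have Aq: "A (Suc h) = Some a'" using q by simp
      then obtain a'' where a'': "A h = Some a''"
        using book_prefix[OF bk h(1)] by (cases "A h") auto
      \<comment> \<open>The upper row of this pair loses \<open>a\<close>, which lies at or below
        \<open>a' - 1\<close>; this supplies the extra 1 for the row that the hole has
        entered.\<close>
      have "a < a'" using old[OF a''] book_increasing[OF bk h(1) a'' Aq] by simp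
      then have "a \<le> a' - 1" by simp
      moreover have "used i 0 (Suc h) a' R"
        using book_used[OF bk _ _ Aq] 2 q s0 by simp
      ultimately show ?thesis using 2 s0 cnt_Suc_h[of "a' - 1"] R_other[of "Suc q"]
        by (simp add: used_def)
    next
      case 3
      then have Aq: "A q = Some a'" "q \<noteq> h" using q by auto
      moreover have "a' < a" using above 3 Aq q(1) by auto
      ultimately show ?thesis using 3 book_used[OF bk q(1,2) Aq(1)] cnt_h[of "a' - 1"]
        by (auto simp: used_def)
    next
      case 4
      then have "A q = Some a'" using q by simp
      then show ?thesis using book_used[OF bk q(1,2)] 4 by (simp add: used_def)
    qed
  qed
  have prefix': "?A (Suc q) = None" if "i \<le> q" "?A q = None" for q
    using book_prefix[OF bk, of q] above that by (auto split: if_splits)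
  have incr': "a1 < a2" if "i \<le> q" "?A q = Some a1" "?A (Suc q) = Some a2" for q a1 a2
  proof -
    consider "q = h" | "Suc q = h" | "q \<noteq> h" "Suc q \<noteq> h" by blast
    then show ?thesis
    proof cases
      case 1
      then have Aq: "A (Suc h) = Some a2" "a1 = a" using that by simp_all
      then obtain a'' where a'': "A h = Some a''"
        using book_prefix[OF bk h(1)] by (cases "A h") auto
      show ?thesis using old[OF a''] book_increasing[OF bk h(1) a'' Aq(1)] Aq(2) by simp
    next
      case 2
      then show ?thesis using above that by auto
    next
      case 3
      then show ?thesis using book_increasing[OF bk that(1)] that by simp
    qed
  qed
  have tail': "x \<in> ?R r \<longleftrightarrow> x \<in> R0 r" if "i \<le> r" "reach b i r * m < x" for r x
  proof -
    have "\<not> reach b i (Suc h) * m < a" "\<not> reach b i h * m < a"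
      using a_le reach_mono by linarith+
    then have "x \<noteq> a" if "r = h \<or> r = Suc h" using that \<open>reach b i r * m < x\<close> by auto
    then show ?thesis using book_tail[OF bk that] by auto
  qed
  have upper': "?R r = R0 r" if "r < i" for r
    using book_upper[OF bk that] that h by simp
  have range': "?R r \<subseteq> {1..N}" for r
    using book_range[OF bk, of r] book_range[OF bk, of "Suc h"] a by auto
  show ?thesis unfolding book_def
    by (intro conjI allI impI) (fact fresh' used' prefix' incr' tail' upper' range')+
qed

section \<open>Invariants during and between slides\<close>

text \<open>The last clause links the hole to the exchange by which it entered its row:
  \<open>z\<close> is at most the entry above the hole, hence smaller than any entry that next moves
  up into the hole. This yields the hypothesis \<open>above\<close> of
  \<open>book_down\<close>.\<close>

definition hole_inv ::
    "nat \<Rightarrow> (nat \<Rightarrow> nat) \<Rightarrow> (nat \<Rightarrow> nat) \<Rightarrow> tableau \<Rightarrow> nat \<times> nat \<Rightarrow> bool" where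
  "hole_inv i s e T p \<longleftrightarrow>
     i \<le> fst p \<and> skew_tab s e {p} T \<and> s (fst p) \<le> snd p \<and> snd p < e (fst p) \<and>
     (\<exists>A. book i s (fst p) A (rowset T) \<and>
       (i < fst p \<longrightarrow> (\<exists>z v. A (fst p - 1) = Some z \<and> T (fst p - 1, snd p) = Some v \<and> z \<le> v)))"

text \<open>The state between slides of phase \<open>i\<close>: the rows below row \<open>i\<close>
  already start in column 0. Keeping the rows up to \<open>i\<close> nonempty ensures that all cells
  to their left belong to \<open>inner_region\<close>.\<close>

definition rect_inv :: "nat \<Rightarrow> (nat \<Rightarrow> nat) \<Rightarrow> (nat \<Rightarrow> nat) \<Rightarrow> tableau \<Rightarrow> bool" where
  "rect_inv i s e T \<longleftrightarrow>
     i < b \<and> skew_tab s e {} T \<and> (\<forall>r>i. s r = 0) \<and> (\<forall>r\<le>i. s r < e r) \<and> e b = 0 \<and>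
     (\<exists>A. book i s b A (rowset T))"

lemma hole_invI:
  assumes "i \<le> h" "skew_tab s e {(h, j)} T" "s h \<le> j" "j < e h" "book i s h A (rowset T)"
    and "i < h \<Longrightarrow> \<exists>z v. A (h - 1) = Some z \<and> T (h - 1, j) = Some v \<and> z \<le> v"
  shows "hole_inv i s e T (h, j)"
  unfolding hole_inv_def fst_conv snd_conv
  by (intro conjI exI[of _ A] impI assms)

lemma rect_invD:
  assumes "rect_inv i s e T"
  shows "i < b" "skew_tab s e {} T" "\<forall>r>i. s r = 0" "\<forall>r\<le>i. s r < e r" "e b = 0"
  using assms unfolding rect_inv_def by - ((elim conjE, assumption)+)

lemma hole_inv_right:
  assumes inv: "hole_inv i s e T (h, j)" and x: "T (h, Suc j) = Some x"
    and below: "\<And>a. T (Suc h, j) = Some a \<Longrightarrow> \<not> a < x"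
  shows "hole_inv i s e (T((h, j) := Some x, (h, Suc j) := None)) (h, Suc j)"
proof -
  from inv have ih: "i \<le> h" and sk: "skew_tab s e {(h, j)} T" and j: "s h \<le> j" "j < e h"
    by (simp_all only: hole_inv_def fst_conv snd_conv)
  from inv obtain A where bk: "book i s h A (rowset T)"
    and above: "i < h \<Longrightarrow> \<exists>z v. A (h - 1) = Some z \<and> T (h - 1, j) = Some v \<and> z \<le> v"
    unfolding hole_inv_def fst_conv snd_conv by blast
  have below': "\<forall>a. T (Suc h, j) = Some a \<longrightarrow> \<not> a < x" using below by blast
  note move = skew_right_move[OF sk j x below']
  have "\<exists>z v. A (h - 1) = Some z \<and> (T((h, j) := Some x, (h, Suc j) := None)) (h - 1, Suc j) = Some v \<and> z \<le> v"
    if "i < h"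
  proof -
    obtain z v where zv: "A (h - 1) = Some z" "T (h - 1, j) = Some v" "z \<le> v"
      using above[OF \<open>i < h\<close>] by blast
    \<comment> \<open>The row above extends at least as far as row \<open>h\<close>, so the hole
      again has an entry above it, larger than the previous one \<open>v\<close>.\<close>
    have "s (h - 1) \<le> Suc j" using skew_SomeD[OF sk zv(2)] by simp
    moreover have "Suc j < e (h - 1)"
      using move(2) skew_antimono_e[OF sk, of "h - 1" h] by simp
    ultimately obtain w where w: "T (h - 1, Suc j) = Some w"
      using skew_filled[OF sk, of "h - 1" "Suc j"] by auto
    have "v < w" using skew_row[OF sk _ zv(2) w] by simp
    moreover have "h - 1 \<noteq> h" using that by simp
    ultimately show ?thesis using zv w by auto
  qed
  moreover have "book i s h A (rowset (T((h, j) := Some x, (h, Suc j) := None)))"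
    using bk by (simp only: move(3))
  moreover have "s h \<le> Suc j" using j by simp
  ultimately show ?thesis
    using ih move(1,2) by (intro hole_invI)
qed

lemma hole_inv_down:
  assumes inv: "hole_inv i s e T (h, j)" and a: "T (Suc h, j) = Some a"
    and right: "\<And>c. T (h, Suc j) = Some c \<Longrightarrow> a < c"
    and s0: "\<And>r. i < r \<Longrightarrow> s r = 0" and eb: "e b = 0"
  shows "hole_inv i s e (T((h, j) := Some a, (Suc h, j) := None)) (Suc h, j)"
proof -
  from inv have ih: "i \<le> h" and sk: "skew_tab s e {(h, j)} T" and j: "s h \<le> j" "j < e h"
    by (simp_all only: hole_inv_def fst_conv snd_conv)
  from inv obtain A where bk: "book i s h A (rowset T)"
    and above: "i < h \<Longrightarrow> \<exists>z v. A (h - 1) = Some z \<and> T (h - 1, j) = Some v \<and> z \<le> v"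
    unfolding hole_inv_def fst_conv snd_conv by blast
  have right': "\<forall>c. T (h, Suc j) = Some c \<longrightarrow> a < c" using right by blast
  note move = skew_down_move[OF sk j a right']
  have hb: "Suc h < b"
    using move(3) skew_antimono_e[OF sk, of b "Suc h"] eb by (cases "Suc h < b") simp_all
  have s0': "s (Suc h) = 0" using s0 ih by simp
  have "book i s (Suc h) (A(h := Some a))
      ((rowset T)(h := insert a (rowset T h), Suc h := rowset T (Suc h) - {a}))"
  proof (rule book_down[OF bk ih hb move(5,6) _ _ _ s0'])
    show "cnt (rowset T (Suc h)) x \<le> cnt (rowset T h) x + s h" if "x < a" for x
      using move(7)[OF that] by simp
    show "cnt (rowset T (Suc h)) a = cnt (rowset T h) a + s h + 1"
      using move(8) s0' by simp
    assume "i < h"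
    then obtain z v where zv: "A (h - 1) = Some z" "T (h - 1, j) = Some v" "z \<le> v"
      using above by blast
    have "v < a" using skew_col[OF sk _ zv(2) a] by simp
    with zv show "\<exists>z. A (h - 1) = Some z \<and> z < a" by auto
  qed
  then have "book i s (Suc h) (A(h := Some a)) (rowset (T((h, j) := Some a, (Suc h, j) := None)))"
    by (simp only: move(4))
  moreover have "\<exists>z v. (A(h := Some a)) (Suc h - 1) = Some z \<and>
      (T((h, j) := Some a, (Suc h, j) := None)) (Suc h - 1, j) = Some v \<and> z \<le> v"
    by (intro exI[of _ a]) simp
  moreover have "i \<le> Suc h" using ih by simp
  ultimately show ?thesis
    using move(1-3) by (intro hole_invI)
qed

text \<open>Empty neighbours make the hole the last cell of row \<open>h\<close>, with row
  \<open>Suc h\<close> ending no later than column \<open>j\<close>; deleting it leaves a skew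
  shape. The bound \<open>Suc (s i) < e i\<close> keeps row \<open>i\<close> nonempty if the slide
  ends there.\<close>

lemma hole_inv_stop:
  assumes inv: "hole_inv i s e T (h, j)"
    and stop: "T (Suc h, j) = None" "T (h, Suc j) = None"
    and i: "i < b" and s0: "\<And>r. i < r \<Longrightarrow> s r = 0" and eb: "e b = 0"
    and nonempty: "\<And>r. r < i \<Longrightarrow> s r < e r" "Suc (s i) < e i"
  shows "rect_inv i s (e(h := e h - 1)) T"
proof -
  from inv have ih: "i \<le> h" and sk: "skew_tab s e {(h, j)} T" and j: "s h \<le> j" "j < e h"
    by (simp_all only: hole_inv_def fst_conv snd_conv)
  from inv obtain A where bk: "book i s h A (rowset T)"
    unfolding hole_inv_def fst_conv snd_conv by blast
  have eh: "e h = Suc j"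
  proof (rule ccontr)
    assume "e h \<noteq> Suc j"
    then obtain x where "T (h, Suc j) = Some x"
      using skew_filled[OF sk, of h "Suc j"] j by auto
    with stop show False by simp
  qed
  have eSh: "e (Suc h) \<le> j"
  proof (rule ccontr)
    assume "\<not> e (Suc h) \<le> j"
    then obtain x where "T (Suc h, j) = Some x"
      using skew_filled[OF sk, of "Suc h" j] j skew_antimono_s[OF sk, of h "Suc h"] by auto
    with stop show False by simp
  qed
  let ?e = "e(h := e h - 1)"
  have "skew_tab s ?e {} T"
    unfolding skew_tab_def
  proof (intro conjI)
    show "antimono s"
      using sk unfolding skew_tab_def by (elim conjE)
    show "antimono ?e"
    proof (rule antimonoI)
      fix r r' :: nat assume "r \<le> r'"
      consider "r = h" "h < r'" | "r = h" "r' = h" | "r \<noteq> h"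
        using \<open>r \<le> r'\<close> by linarith
      then show "?e r' \<le> ?e r"
      proof cases
        case 1
        then have "e r' \<le> e (Suc h)" using skew_antimono_e[OF sk] by simp
        with 1 eSh eh show ?thesis by simp
      next
        case 3
        then show ?thesis using skew_antimono_e[OF sk \<open>r \<le> r'\<close>] by (cases "r' = h") auto
      qed simp
    qed
    show "\<forall>r. s r \<le> ?e r"
      using skew_le[OF sk] j eh by simp
    show "dom T = {(r, c). s r \<le> c \<and> c < ?e r} - {}"
      unfolding skew_dom[OF sk] using eh by (auto split: if_splits)
    show "\<forall>r c c' y z. c < c' \<longrightarrow> T (r, c) = Some y \<longrightarrow> T (r, c') = Some z \<longrightarrow> y < z"
      using sk unfolding skew_tab_def by (elim conjE)
    show "\<forall>r r' c y z. r < r' \<longrightarrow> T (r, c) = Some y \<longrightarrow> T (r', c) = Some z \<longrightarrow> y < z"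
      using sk unfolding skew_tab_def by (elim conjE)
    show "\<forall>q q' y. T q = Some y \<longrightarrow> T q' = Some y \<longrightarrow> q = q'"
      using sk unfolding skew_tab_def by (elim conjE)
  qed
  moreover have "\<forall>r\<le>i. s r < ?e r"
    using nonempty ih by (auto simp: le_less)
  moreover have "book i s b A (rowset T)"
    by (rule book_weaken[OF bk]) simp
  ultimately show ?thesis
    using i s0 eb nonempty j eh ih unfolding rect_inv_def by (intro conjI exI[of _ A]) auto
qed

lemma rect_inv_start:
  assumes inv: "rect_inv i s e T" and si: "s i = Suc t"
  shows "hole_inv i (s(i := t)) e T (i, t)"
proof -
  have sk: "skew_tab s e {} T" and s0: "\<forall>r>i. s r = 0" and se: "\<forall>r\<le>i. s r < e r"
    by (fact rect_invD[OF inv])+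
  from inv obtain A where bk: "book i s b A (rowset T)" unfolding rect_inv_def by blast
  let ?s = "s(i := t)"
  have "skew_tab ?s e {(i, t)} T"
    unfolding skew_tab_def
  proof (intro conjI)
    show "antimono ?s"
    proof (rule antimonoI)
      fix r r' :: nat assume "r \<le> r'"
      consider "i < r'" | "r' = i" "r = i" | "r' = i" "r < i" | "r' < i"
        using \<open>r \<le> r'\<close> by linarith
      then show "?s r' \<le> ?s r"
        using skew_antimono_s[OF sk \<open>r \<le> r'\<close>] s0 si \<open>r \<le> r'\<close> by cases auto
    qed
    show "antimono e"
      using sk unfolding skew_tab_def by (elim conjE)
    show "\<forall>r. ?s r \<le> e r"
      using skew_le[OF sk] se[rule_format, of i] si by simp
    show "dom T = {(r, c). ?s r \<le> c \<and> c < e r} - {(i, t)}"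
      unfolding skew_dom[OF sk] using si by (auto split: if_splits)
    show "\<forall>r c c' y z. c < c' \<longrightarrow> T (r, c) = Some y \<longrightarrow> T (r, c') = Some z \<longrightarrow> y < z"
      using sk unfolding skew_tab_def by (elim conjE)
    show "\<forall>r r' c y z. r < r' \<longrightarrow> T (r, c) = Some y \<longrightarrow> T (r', c) = Some z \<longrightarrow> y < z"
      using sk unfolding skew_tab_def by (elim conjE)
    show "\<forall>q q' y. T q = Some y \<longrightarrow> T q' = Some y \<longrightarrow> q = q'"
      using sk unfolding skew_tab_def by (elim conjE)
  qed
  moreover have "book i ?s i A (rowset T)"
    by (rule book_weaken[OF bk]) (use si in auto)
  moreover have "t < e i" using se[rule_format, of i] si by simp
  ultimately show ?thesis unfolding hole_inv_def by auto
qed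

lemma rect_inv_inner_region:
  assumes inv: "rect_inv i s e T"
  shows "inner_region T = {(r, c). c < s r}"
proof -
  have sk: "skew_tab s e {} T" and s0: "\<forall>r>i. s r = 0" and se: "\<forall>r\<le>i. s r < e r"
    by (fact rect_invD[OF inv])+
  show ?thesis
  proof (intro set_eqI iffI)
    fix p assume "p \<in> inner_region T"
    then obtain r c r' c' where p: "p = (r, c)" "(r, c) \<notin> dom T" "(r', c') \<in> dom T" "r \<le> r'" "c \<le> c'"
      unfolding inner_region_def by (cases p) force
    then have "c < e r" using skew_antimono_e[OF sk p(4)] unfolding skew_dom[OF sk] by auto
    with p show "p \<in> {(r, c). c < s r}" unfolding skew_dom[OF sk] by auto
  next
    fix p assume "p \<in> {(r, c). c < s r}"
    then obtain r c where p: "p = (r, c)" "c < s r" by auto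
    then have "r \<le> i" using s0 by (metis not_less_zero not_le)
    then have "(r, s r) \<in> dom T" unfolding skew_dom[OF sk] using se by auto
    moreover have "(r, c) \<notin> dom T" unfolding skew_dom[OF sk] using p by auto
    ultimately show "p \<in> inner_region T" unfolding inner_region_def using p
      by (auto intro!: bexI[of _ "(r, s r)"])
  qed
qed

lemma rect_inv_finite_inner_region:
  assumes inv: "rect_inv i s e T"
  shows "finite (inner_region T)"
proof (rule finite_subset)
  have sk: "skew_tab s e {} T" and s0: "\<forall>r>i. s r = 0"
    by (fact rect_invD[OF inv])+
  show "inner_region T \<subseteq> {..i} \<times> {..<s 0}"
  proof
    fix p assume "p \<in> inner_region T"
    then obtain r c where p: "p = (r, c)" "c < s r" unfolding rect_inv_inner_region[OF inv] by auto
    then have "r \<le> i" using s0 by (metis not_less_zero not_le)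
    moreover have "c < s 0" using p skew_antimono_s[OF sk, of 0 r] by simp
    ultimately show "p \<in> {..i} \<times> {..<s 0}" using p by simp
  qed
qed simp

lemma rect_inv_step:
  assumes inv: "rect_inv i s e T" and si: "s i = Suc t"
  shows "\<exists>e'. rect_inv i (s(i := t)) e' (rect_step T)"
proof -
  have i: "i < b" and sk: "skew_tab s e {} T" and s0: "\<forall>r>i. s r = 0"
    and se: "\<forall>r\<le>i. s r < e r" and eb: "e b = 0"
    by (fact rect_invD[OF inv])+
  have inner: "inner_region T = {(r, c). c < s r}" by (rule rect_inv_inner_region[OF inv])
  have fin: "finite (inner_region T)" by (rule rect_inv_finite_inner_region[OF inv])
  \<comment> \<open>\<open>inner_corner\<close> takes the lowest possible row first, and all rows
    below row \<open>i\<close> start in column 0. This is why phases run upwards.\<close>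
  have "Max (fst ` inner_region T) = i"
  proof (rule Max_eqI)
    show "finite (fst ` inner_region T)" using fin by simp
    show "i \<in> fst ` inner_region T" unfolding inner using si by force
    show "r \<le> i" if "r \<in> fst ` inner_region T" for r
      using that s0 unfolding inner by (force simp: not_le[symmetric])
  qed
  moreover have "Max {j. (i, j) \<in> inner_region T} = t"
    unfolding inner using si by (intro Max_eqI) auto
  ultimately have corner: "inner_corner T = (i, t)" by (simp add: inner_corner_def)
  have "(i, t) \<in> inner_region T" unfolding inner using si by simp
  then have step: "rect_step T = slide (card (dom T)) T (i, t)"
    unfolding rect_step_def corner by auto
  have fin_dom: "finite (dom T)"
  proof (rule finite_subset)
    show "dom T \<subseteq> {..<b} \<times> {..<e 0}"
    proof
      fix p assume "p \<in> dom T"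
      then obtain r c where p: "p = (r, c)" "c < e r" unfolding skew_dom[OF sk] by auto
      have "r < b" using p skew_antimono_e[OF sk, of b r] eb by (cases "r < b") auto
      moreover have "c < e 0" using p skew_antimono_e[OF sk, of 0 r] by simp
      ultimately show "p \<in> {..<b} \<times> {..<e 0}" using p by simp
    qed
  qed simp
  let ?s = "s(i := t)"
  have s0': "?s r = 0" if "i < r" for r using s0 that by simp
  have "\<exists>h' j'. hole_inv i ?s e (slide (card (dom T)) T (i, t)) (h', j') \<and>
      slide (card (dom T)) T (i, t) (Suc h', j') = None \<and>
      slide (card (dom T)) T (i, t) (h', Suc j') = None"
  proof (rule slide_invariant[where Inv = "hole_inv i ?s e"])
    show "hole_inv i ?s e T (i, t)" by (rule rect_inv_start[OF inv si])
    show "card {p \<in> dom T. i \<le> fst p \<and> t \<le> snd p} \<le> card (dom T)"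
      using fin_dom by (auto intro: card_mono)
    show "hole_inv i ?s e (T'((h, j) := Some x, (h, Suc j) := None)) (h, Suc j)"
      if "hole_inv i ?s e T' (h, j)" "T' (h, Suc j) = Some x"
        "\<And>a. T' (Suc h, j) = Some a \<Longrightarrow> \<not> a < x" for T' h j x
      using that by (rule hole_inv_right)
    show "hole_inv i ?s e (T'((h, j) := Some a, (Suc h, j) := None)) (Suc h, j)"
      if "hole_inv i ?s e T' (h, j)" "T' (Suc h, j) = Some a"
        "\<And>c. T' (h, Suc j) = Some c \<Longrightarrow> a < c" for T' h j a
      using that s0' eb by (rule hole_inv_down)
  qed (fact fin_dom)
  then obtain h' j' where h': "hole_inv i ?s e (rect_step T) (h', j')"
    "rect_step T (Suc h', j') = None" "rect_step T (h', Suc j') = None"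
    unfolding step by blast
  have "rect_inv i ?s (e(h' := e h' - 1)) (rect_step T)"
    by (rule hole_inv_stop[OF h' i s0' eb]) (use se si in auto)
  then show ?thesis by blast
qed

lemma rect_inv_next_phase:
  assumes inv: "rect_inv (Suc i) s e T" and "s (Suc i) = 0"
  shows "rect_inv i s e T"
proof -
  have *: "Suc i < b" "skew_tab s e {} T" "\<forall>r>Suc i. s r = 0" "\<forall>r\<le>Suc i. s r < e r" "e b = 0"
    by (fact rect_invD[OF inv])+
  from inv obtain A where "book (Suc i) s b A (rowset T)" unfolding rect_inv_def by blast
  from book_next_phase[OF this *(1)] have "book i s b (\<lambda>_. None) (rowset T)" .
  moreover have "\<forall>r>i. s r = 0" using *(3) assms(2) by (metis Suc_lessI)
  moreover have "i < b" "\<forall>r\<le>i. s r < e r" using * by simp_all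
  ultimately show ?thesis using *(2,5) unfolding rect_inv_def by blast
qed

lemma rect_inv_skip_phases:
  assumes "rect_inv i s e T"
  shows "\<exists>i'. rect_inv i' s e T \<and> (i' = 0 \<or> 0 < s i')"
  using assms
proof (induction i)
  case (Suc i)
  then show ?case using rect_inv_next_phase by blast
qed blast

text \<open>Each slide removes exactly its corner from the inner region, so the iteration count in
  \<open>Rect\<close> is the number of slides needed. Between slides, phases whose row already
  starts in column 0 are skipped.\<close>

lemma rect_inv_Rect:
  assumes "rect_inv i s e T"
  shows "\<exists>s e. rect_inv 0 s e (Rect T)"
proof -
  have "\<exists>s e. rect_inv 0 s e ((rect_step ^^ n) T)" if "rect_inv i s e T" "card (inner_region T) = n"
    for n i s e T
    using that
  proof (induction n arbitrary: i s e T)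
    case 0
    obtain i' where i': "rect_inv i' s e T" "i' = 0 \<or> 0 < s i'"
      using rect_inv_skip_phases[OF 0(1)] by blast
    have "inner_region T = {}" using rect_inv_finite_inner_region[OF 0(1)] 0(2) by simp
    then have "s i' = 0" unfolding rect_inv_inner_region[OF 0(1)] by auto
    with i' have "rect_inv 0 s e T" by simp
    then show ?case by auto
  next
    case (Suc n)
    obtain i' where i': "rect_inv i' s e T" "i' = 0 \<or> 0 < s i'"
      using rect_inv_skip_phases[OF Suc.prems(1)] by blast
    have ne: "inner_region T \<noteq> {}" using Suc.prems(2) by auto
    have "s i' \<noteq> 0"
    proof
      assume "s i' = 0"
      with i' have "i' = 0" by simp
      with i'(1) \<open>s i' = 0\<close> have "s r = 0" for r
        unfolding rect_inv_def by (cases r) auto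
      with ne show False unfolding rect_inv_inner_region[OF i'(1)] by simp
    qed
    then obtain t where t: "s i' = Suc t" by (cases "s i'") auto
    obtain e' where e': "rect_inv i' (s(i' := t)) e' (rect_step T)"
      using rect_inv_step[OF i'(1) t] by blast
    have "inner_region (rect_step T) = inner_region T - {(i', t)}"
      unfolding rect_inv_inner_region[OF e'] rect_inv_inner_region[OF i'(1)]
      using t by (auto split: if_splits)
    moreover have "(i', t) \<in> inner_region T"
      unfolding rect_inv_inner_region[OF i'(1)] using t by simp
    ultimately have "card (inner_region (rect_step T)) = n"
      using Suc.prems(2) by simp
    from Suc.IH[OF e' this] show ?case by (simp only: funpow_Suc_right o_apply)
  qed
  then show ?thesis using assms unfolding Rect_def by blast
qed

lemma rect_inv_first_phase:
  assumes "skew_tab s e {} T" "rowset T = R0" "\<And>r. R0 r \<subseteq> {1..N}"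
    and "\<And>r. r < b \<Longrightarrow> s r < e r" "\<And>r. b \<le> r \<Longrightarrow> s r = 0" "e b = 0"
  shows "rect_inv (b - 1) s e T"
proof -
  have "b - 1 < b" using b_ge_2 by simp
  moreover have "\<forall>r>b - 1. s r = 0" using assms(5) by simp
  moreover have "\<forall>r\<le>b - 1. s r < e r" using assms(4) b_ge_2 by simp
  moreover have "book (b - 1) s b (\<lambda>_. None) (rowset T)"
    using book_first_phase[OF assms(3)] assms(2) by simp
  ultimately show ?thesis using assms(1,6) unfolding rect_inv_def by blast
qed

text \<open>After phase 0 every row agrees with the original beyond \<open>reach b 0 r\<close>
  blocks. The cap in \<open>reach\<close> is sound because the bottom row exchanges entries only
  with the row above it, whose own value is at most \<open>2 * b - 3\<close>.\<close>

lemma rect_inv_stable: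
  assumes "rect_inv 0 s e T" and "(2 * b - 3) * m < x"
  shows "x \<in> rowset T r \<longleftrightarrow> x \<in> R0 r"
proof -
  obtain A where bk: "book 0 s b A (rowset T)" using assms(1) unfolding rect_inv_def by blast
  have "reach b 0 r \<le> 2 * b - 3" by (simp add: reach_def)
  then have "reach b 0 r * m < x" using assms(2) mult_le_mono1 le_less_trans by blast
  then show ?thesis using book_tail[OF bk] by simp
qed

end

section \<open>Powers of a skew tableau\<close>

text \<open>Here \<open>t\<close> and \<open>t'\<close> are block numbers in an upper and a lower
  row. The lower row starts no further right and has blocks no longer, so a column that is not
  further left cannot lie in an earlier block of it.\<close>

lemma div_lex_le:
  fixes a t a' t' n n' s s' :: nat
  assumes "s + t * n + a \<le> s' + t' * n' + a'" "a' < n'" "n' \<le> n" "s' \<le> s"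
  shows "t \<le> t'"
proof (rule ccontr)
  assume "\<not> t \<le> t'"
  then have "Suc t' * n' \<le> t * n" using assms(3) by (intro mult_le_mono) auto
  with assms show False by simp
qed

text \<open>Block number \<open>t\<close> and offset \<open>a\<close> inside the block replace
  \<open>div\<close> and \<open>mod\<close> in all later arguments.\<close>

lemma tab_power_eq_Some:
  assumes sk: "skew_tab s e {} S" and "m = card (dom S)"
  shows "tab_power S k (r, c) = Some y \<longleftrightarrow>
    (\<exists>t a x. t < k \<and> a < e r - s r \<and> c = s r + t * (e r - s r) + a \<and>
      S (r, s r + a) = Some x \<and> y = x + t * m)"
proof -
  let ?n = "e r - s r"
  have cols: "{j. (r, j) \<in> dom S} = {s r..<e r}" unfolding skew_dom[OF sk] by auto
  show ?thesis
  proof (cases "s r < e r")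
    case False
    \<comment> \<open>In an empty row \<open>row_start\<close> is the minimum of an empty set, but
      its value is harmless: the column range has length 0 and both sides are false.\<close>
    then show ?thesis by (auto simp: tab_power_def row_len_def cols Let_def)
  next
    case True
    have len: "row_len S r = ?n" by (simp add: row_len_def cols)
    have start: "row_start S r = s r"
      unfolding row_start_def cols using True by (intro Min_eqI) auto
    have eq: "tab_power S k (r, c) = (if s r \<le> c \<and> c < s r + k * ?n
        then map_option (\<lambda>x. x + ((c - s r) div ?n) * m) (S (r, s r + (c - s r) mod ?n)) else None)"
      by (simp add: tab_power_def len start assms(2) Let_def)
    show ?thesis
    proof
      assume "tab_power S k (r, c) = Some y"
      then have c: "s r \<le> c" "c < s r + k * ?n"
        and "\<exists>x. S (r, s r + (c - s r) mod ?n) = Some x \<and> y = x + ((c - s r) div ?n) * m"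
        unfolding eq by (auto split: if_splits)
      moreover have "(c - s r) div ?n < k"
        using c True by (intro less_mult_imp_div_less) linarith
      moreover have "c = s r + (c - s r) div ?n * ?n + (c - s r) mod ?n"
        using c by (simp only: add.assoc div_mult_mod_eq le_add_diff_inverse)
      moreover have "(c - s r) mod ?n < ?n" using True by simp
      ultimately show "\<exists>t a x. t < k \<and> a < ?n \<and> c = s r + t * ?n + a \<and>
          S (r, s r + a) = Some x \<and> y = x + t * m" by blast
    next
      assume "\<exists>t a x. t < k \<and> a < ?n \<and> c = s r + t * ?n + a \<and>
          S (r, s r + a) = Some x \<and> y = x + t * m"
      then obtain t a x where *: "t < k" "a < ?n" "c = s r + t * ?n + a"
          "S (r, s r + a) = Some x" "y = x + t * m" by blast
      have "Suc t * ?n \<le> k * ?n" using *(1) by (intro mult_le_mono1) simp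
      then have "c < s r + k * ?n" using * by simp
      moreover have "c - s r = a + t * ?n" using * by simp
      then have "(c - s r) div ?n = t" "(c - s r) mod ?n = a" using *(2) by simp_all
      ultimately show "tab_power S k (r, c) = Some y" unfolding eq using * by simp
    qed
  qed
qed

lemma skew_tab_power:
  assumes sk: "skew_tab s e {} S" and m: "m = card (dom S)"
    and len: "\<And>r r'. r \<le> r' \<Longrightarrow> e r' - s r' \<le> e r - s r"
    and range: "\<And>r. rowset S r \<subseteq> {1..m}"
  shows "skew_tab s (\<lambda>r. s r + k * (e r - s r)) {} (tab_power S k)"
proof -
  let ?n = "\<lambda>r. e r - s r"
  have bounds: "1 \<le> x \<and> x \<le> m" if "S (r, c) = Some x" for r c x
    using range[of r] that by (auto simp: rowset_def)
  \<comment> \<open>Entries of \<open>S\<close> lie between 1 and \<open>m\<close>, so different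
    blocks occupy disjoint intervals of values.\<close>
  have later: "x + t * m < x' + t' * m"
    if "S (r, c) = Some x" "S (r', c') = Some x'" "t < t'" for r c x r' c' x' t t'
  proof -
    have "Suc t * m \<le> t' * m" using that(3) by (intro mult_le_mono1) simp
    then show ?thesis using bounds[OF that(1)] bounds[OF that(2)] by simp
  qed
  show ?thesis
    unfolding skew_tab_def
  proof (intro conjI)
    show "antimono s"
      using sk unfolding skew_tab_def by (elim conjE)
    show "antimono (\<lambda>r. s r + k * ?n r)"
      using skew_antimono_s[OF sk] len by (intro antimonoI add_mono mult_le_mono2)
    show "\<forall>r. s r \<le> s r + k * ?n r" by simp
    show "dom (tab_power S k) = {(r, c). s r \<le> c \<and> c < s r + k * ?n r} - {}"
    proof (intro set_eqI iffI)
      fix p assume "p \<in> dom (tab_power S k)"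
      then obtain r c y where p: "p = (r, c)" "tab_power S k (r, c) = Some y" by (cases p) auto
      then obtain t a where *: "t < k" "a < ?n r" "c = s r + t * ?n r + a"
        unfolding tab_power_eq_Some[OF sk m] by blast
      have "Suc t * ?n r \<le> k * ?n r" using *(1) by (intro mult_le_mono1) simp
      with * p show "p \<in> {(r, c). s r \<le> c \<and> c < s r + k * ?n r} - {}" by simp
    next
      fix p assume "p \<in> {(r, c). s r \<le> c \<and> c < s r + k * ?n r} - {}"
      then obtain r c where p: "p = (r, c)" "s r \<le> c" "c < s r + k * ?n r" by auto
      then have n: "0 < ?n r" by (cases "?n r") auto
      define t a where "t = (c - s r) div ?n r" and "a = (c - s r) mod ?n r"
      have "t < k" unfolding t_def using p n by (intro less_mult_imp_div_less) linarith
      moreover have "a < ?n r" unfolding a_def using n by simp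
      moreover have "c = s r + t * ?n r + a" unfolding t_def a_def using p by (simp only: add.assoc div_mult_mod_eq le_add_diff_inverse)
      moreover have "s r + a < e r" using \<open>a < ?n r\<close> by simp
      then obtain x where "S (r, s r + a) = Some x"
        using skew_filled[OF sk, of r "s r + a"] by auto
      ultimately have "\<exists>y. tab_power S k (r, c) = Some y"
        unfolding tab_power_eq_Some[OF sk m] by blast
      with p show "p \<in> dom (tab_power S k)" by auto
    qed
    show "\<forall>r c c' y z. c < c' \<longrightarrow> tab_power S k (r, c) = Some y \<longrightarrow>
        tab_power S k (r, c') = Some z \<longrightarrow> y < z"
    proof (intro allI impI)
      fix r c c' y z
      assume "c < c'" "tab_power S k (r, c) = Some y" "tab_power S k (r, c') = Some z"
      then obtain t a x t' a' x' where *: "a < ?n r" "c = s r + t * ?n r + a"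
          "S (r, s r + a) = Some x" "y = x + t * m" "a' < ?n r" "c' = s r + t' * ?n r + a'"
          "S (r, s r + a') = Some x'" "z = x' + t' * m"
        unfolding tab_power_eq_Some[OF sk m] by blast
      have "t \<le> t'" by (rule div_lex_le[of "s r" t "?n r" a "s r" t' "?n r" a']) (use * \<open>c < c'\<close> in auto)
      then consider "t < t'" | "t = t'" by linarith
      then show "y < z"
      proof cases
        case 1
        then show ?thesis using later[OF *(3,7)] * by simp
      next
        case 2
        then have "s r + a < s r + a'" using * \<open>c < c'\<close> by simp
        with 2 * skew_row[OF sk this *(3,7)] show ?thesis by simp
      qed
    qed
    show "\<forall>r r' c y z. r < r' \<longrightarrow> tab_power S k (r, c) = Some y \<longrightarrow>
        tab_power S k (r', c) = Some z \<longrightarrow> y < z"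
    proof (intro allI impI)
      fix r r' c y z
      assume "r < r'" "tab_power S k (r, c) = Some y" "tab_power S k (r', c) = Some z"
      then obtain t a x t' a' x' where *: "a < ?n r" "c = s r + t * ?n r + a"
          "S (r, s r + a) = Some x" "y = x + t * m" "a' < ?n r'" "c = s r' + t' * ?n r' + a'"
          "S (r', s r' + a') = Some x'" "z = x' + t' * m"
        unfolding tab_power_eq_Some[OF sk m] by blast
      have le: "?n r' \<le> ?n r" "s r' \<le> s r"
        using len skew_antimono_s[OF sk] \<open>r < r'\<close> by simp_all
      have "t \<le> t'"
        by (rule div_lex_le[of "s r" t "?n r" a "s r'" t' "?n r'" a']) (use * le in auto)
      then consider "t < t'" | "t = t'" by linarith
      then show "y < z"
      proof cases
        case 1
        then show ?thesis using later[OF *(3,7)] * by simp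
      next
        case 2
        \<comment> \<open>Within one block, the shorter blocks of the lower row place
          \<open>x'\<close> in \<open>S\<close> weakly right of the column of \<open>x\<close>. The
          entry \<open>u\<close> directly below \<open>x\<close> in that row then lies between
          \<open>x\<close> and \<open>x'\<close>.\<close>
        have "s r + t * ?n r + a = s r' + t * ?n r' + a'" using 2 *(2,6) by simp
        moreover have "t * ?n r' \<le> t * ?n r" using le(1) by (rule mult_le_mono2)
        ultimately have le': "s r + a \<le> s r' + a'" by linarith
        then have "s r + a < e r'" using *(5) by linarith
        then obtain u where u: "S (r', s r + a) = Some u"
          using skew_filled[OF sk, of r' "s r + a"] le by auto
        have "x < u" using skew_col[OF sk \<open>r < r'\<close> *(3) u] .
        also have "u \<le> x'"
          using skew_row[OF sk _ u *(7)] u *(7) le' by (cases "s r + a = s r' + a'") auto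
        finally show ?thesis using 2 * by simp
      qed
    qed
    show "\<forall>p p' y. tab_power S k p = Some y \<longrightarrow> tab_power S k p' = Some y \<longrightarrow> p = p'"
    proof (intro allI impI)
      fix p p' y assume "tab_power S k p = Some y" "tab_power S k p' = Some y"
      moreover obtain r c r' c' where p: "p = (r, c)" "p' = (r', c')" by (cases p, cases p')
      ultimately obtain t a x t' a' x' where *: "c = s r + t * ?n r + a"
          "S (r, s r + a) = Some x" "y = x + t * m" "c' = s r' + t' * ?n r' + a'"
          "S (r', s r' + a') = Some x'" "y = x' + t' * m"
        unfolding p tab_power_eq_Some[OF sk m] by blast
      have "t = t'"
        using later[OF *(2,5), of t t'] later[OF *(5,2), of t' t] *(3,6)
        by (metis linorder_neqE_nat less_irrefl)
      with * have "x = x'" by simp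
      then have "S (r', s r' + a') = Some x" using *(5) by simp
      from skew_inj[OF sk *(2) this] have "(r, s r + a) = (r', s r' + a')" .
      then have "r = r'" "a = a'" by auto
      with * \<open>t = t'\<close> p show "p = p'" by simp
    qed
  qed
qed

lemma rowset_tab_power:
  assumes sk: "skew_tab s e {} S" and m: "m = card (dom S)"
  shows "rowset (tab_power S k) r = {x + t * m |x t. t < k \<and> x \<in> rowset S r}"
proof (intro set_eqI iffI)
  fix y assume "y \<in> rowset (tab_power S k) r"
  then obtain c where "tab_power S k (r, c) = Some y" by (auto simp: rowset_def)
  then show "y \<in> {x + t * m |x t. t < k \<and> x \<in> rowset S r}"
    unfolding tab_power_eq_Some[OF sk m] rowset_def by blast
next
  fix y assume "y \<in> {x + t * m |x t. t < k \<and> x \<in> rowset S r}"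
  then obtain x t c where *: "y = x + t * m" "t < k" "S (r, c) = Some x"
    unfolding rowset_def by blast
  have "c = s r + (c - s r)" "c - s r < e r - s r" using skew_SomeD[OF sk *(3)] by auto
  with * have "tab_power S k (r, s r + t * (e r - s r) + (c - s r)) = Some y"
    unfolding tab_power_eq_Some[OF sk m] by metis
  then show "y \<in> rowset (tab_power S k) r" unfolding rowset_def by blast
qed

text \<open>Membership in a row of the power has period \<open>m\<close>, so any \<open>m\<close>
  consecutive values in its range contain as many entries as the first block, which is the row of
  \<open>S\<close> itself.\<close>

lemma cnt_rowset_tab_power:
  assumes sk: "skew_tab s e {} S" and m: "m = card (dom S)"
    and range: "\<And>r. rowset S r \<subseteq> {1..m}" and k: "x + m \<le> k * m" and m_pos: "0 < m"
  shows "cnt (rowset (tab_power S k) r) (x + m) = cnt (rowset (tab_power S k) r) x + (e r - s r)"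
proof -
  let ?R = "rowset (tab_power S k) r"
  have bounds: "1 \<le> x" "x \<le> m" if "x \<in> rowset S r" for x
    using range[of r] that by auto
  have "0 < k" using k m_pos by (cases k) auto
  have R: "y \<in> ?R \<longleftrightarrow> (\<exists>x t. y = x + t * m \<and> t < k \<and> x \<in> rowset S r)" for y
    unfolding rowset_tab_power[OF sk m] by blast
  \<comment> \<open>The value 0 is excluded, since it is never an entry while \<open>m\<close> may
    be one.\<close>
  have "y \<in> ?R \<longleftrightarrow> y + m \<in> ?R" if "0 < y" "y + m \<le> k * m" for y
  proof
    assume "y \<in> ?R"
    then obtain x t where *: "y = x + t * m" "t < k" "x \<in> rowset S r" unfolding R by blast
    have "Suc t * m < k * m" using * bounds(1)[OF *(3)] that(2) by simp
    then have "Suc t < k" by (simp only: mult_less_cancel2)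
    moreover have "y + m = x + Suc t * m" using * by simp
    ultimately show "y + m \<in> ?R" unfolding R using *(3) by blast
  next
    assume "y + m \<in> ?R"
    then obtain x t where *: "y + m = x + t * m" "t < k" "x \<in> rowset S r" unfolding R by blast
    then obtain t' where t': "t = Suc t'"
      using bounds(2)[OF *(3)] \<open>0 < y\<close> by (cases t) auto
    then have "y = x + t' * m" "t' < k" using * by simp_all
    then show "y \<in> ?R" unfolding R using *(3) by blast
  qed
  moreover have "0 \<notin> ?R" unfolding R using bounds(1) by force
  ultimately have "cnt ?R (x + m) = cnt ?R x + cnt ?R m"
    using k by (intro cnt_periodic[where N = "k * m"]) auto
  moreover have "{y \<in> ?R. y \<le> m} = {y \<in> rowset S r. y \<le> m}"
  proof (intro set_eqI iffI)
    fix y assume "y \<in> {y \<in> ?R. y \<le> m}"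
    then obtain x t where *: "y = x + t * m" "x \<in> rowset S r" "y \<le> m" unfolding R by auto
    have "t = 0" using * bounds(1)[OF *(2)] by (cases t) auto
    with * show "y \<in> {y \<in> rowset S r. y \<le> m}" by simp
  next
    fix y assume "y \<in> {y \<in> rowset S r. y \<le> m}"
    moreover have "y = y + 0 * m" by simp
    ultimately show "y \<in> {y \<in> ?R. y \<le> m}" using \<open>0 < k\<close> unfolding R by blast
  qed
  then have "cnt ?R m = cnt (rowset S r) m" by (simp only: cnt_def)
  moreover have "cnt (rowset S r) m = card {c. \<exists>y \<le> m. S (r, c) = Some y}"
    by (rule cnt_eq_card_columns) (use skew_inj[OF sk] in blast)
  moreover have "{c. \<exists>y \<le> m. S (r, c) = Some y} = {s r..<e r}"
  proof (intro set_eqI iffI)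
    fix c assume "c \<in> {c. \<exists>y \<le> m. S (r, c) = Some y}"
    then show "c \<in> {s r..<e r}" using skew_SomeD[OF sk] by auto
  next
    fix c assume "c \<in> {s r..<e r}"
    then obtain y where y: "S (r, c) = Some y" using skew_filled[OF sk, of r c] by auto
    then have "y \<le> m" using bounds(2)[of y] by (auto simp: rowset_def)
    with y show "c \<in> {c. \<exists>y \<le> m. S (r, c) = Some y}" by blast
  qed
  ultimately show ?thesis by simp
qed

section \<open>Standard fillings and the stabilization bound\<close>

lemma standard_filling_skew_tab:
  assumes S: "standard_filling S" and s: "antimono s" and e: "antimono e"
    and le: "\<And>r. s r \<le> e r" and dom: "dom S = {(r, c). s r \<le> c \<and> c < e r}"
  shows "skew_tab s e {} S" and "rowset S r \<subseteq> {1..card (dom S)}"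
proof -
  have bij: "bij_betw (\<lambda>c. the (S c)) (dom S) {1..card (dom S)}"
    using S unfolding standard_filling_def by (elim conjE)
  show "rowset S r \<subseteq> {1..card (dom S)}"
  proof
    fix x assume "x \<in> rowset S r"
    then obtain c where c: "S (r, c) = Some x" unfolding rowset_def by blast
    then have "(r, c) \<in> dom S" by blast
    with bij_betwE[OF bij] have "the (S (r, c)) \<in> {1..card (dom S)}" by blast
    with c show "x \<in> {1..card (dom S)}" by simp
  qed
  show "skew_tab s e {} S"
    unfolding skew_tab_def
  proof (intro conjI)
    show "antimono s" "antimono e" by (fact s e)+
    show "\<forall>r. s r \<le> e r" using le by simp
    show "dom S = {(r, c). s r \<le> c \<and> c < e r} - {}" using dom by simp
    show "\<forall>r c c' x y. c < c' \<longrightarrow> S (r, c) = Some x \<longrightarrow> S (r, c') = Some y \<longrightarrow> x < y"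
      using S unfolding standard_filling_def by meson
    show "\<forall>r r' c x y. r < r' \<longrightarrow> S (r, c) = Some x \<longrightarrow> S (r', c) = Some y \<longrightarrow> x < y"
      using S unfolding standard_filling_def by meson
    show "\<forall>p p' x. S p = Some x \<longrightarrow> S p' = Some x \<longrightarrow> p = p'"
    proof (intro allI impI)
      fix p p' x assume p: "S p = Some x" "S p' = Some x"
      then have "p \<in> dom S" "p' \<in> dom S" by blast+
      with inj_onD[OF bij_betw_imp_inj_on[OF bij], of p p'] p show "p = p'" by simp
    qed
  qed
qed

theorem theorem1p5:
  fixes b :: nat and lam mu :: "nat list" and S :: tableau
  assumes "b \<ge> 2"
    and "length lam = b" and "length mu = b"
    and "weakly_decr lam" and "weakly_decr mu"
    and "\<forall>i<b. mu ! i < lam ! i"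
    and "weakly_decr (map (\<lambda>i. lam ! i - mu ! i) [0..<b])"
    and "dom S = skew_cells lam mu"
    and "standard_filling S"
  shows "stabilizes_at S (2 * b - 2)"
proof -
  \<comment> \<open>Rows from \<open>b\<close> on are empty intervals at column 0, which makes both
    boundaries antitone on all of \<open>nat\<close> and gives \<open>e b = 0\<close>.\<close>
  define s where "s = (\<lambda>r. if r < b then mu ! r else 0)"
  define e where "e = (\<lambda>r. if r < b then lam ! r else 0)"
  define m where "m = card (dom S)"
  define k where "k = 2 * b - 2"
  define T where "T = tab_power S k"
  have anti: "antimono s" "antimono e"
    using assms(2-5) by (auto simp: s_def e_def weakly_decr_def intro!: antimonoI)
  have dom: "dom S = {(r, c). s r \<le> c \<and> c < e r}"
    using assms(2,8) by (auto simp: skew_cells_def s_def e_def split: if_splits)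
  have se: "s r < e r" if "r < b" for r using assms(6) that by (simp add: s_def e_def)
  have le: "s r \<le> e r" for r using assms(6) by (auto simp: s_def e_def less_imp_le)
  have len: "e r' - s r' \<le> e r - s r" if "r \<le> r'" for r r'
    using assms(7) that by (auto simp: weakly_decr_def s_def e_def)
  note sk = standard_filling_skew_tab(1)[OF assms(9) anti le dom]
  note range = standard_filling_skew_tab(2)[OF assms(9) anti le dom, folded m_def]
  have "finite (dom S)" using assms(9) by (simp add: standard_filling_def)
  moreover have "(0, s 0) \<in> dom S" using se[of 0] assms(1) dom by auto
  ultimately have m_pos: "0 < m" unfolding m_def by (auto simp: card_gt_0_iff)
  have k: "k - 1 = 2 * b - 3" unfolding k_def by simp
  interpret periodic_rows b m "k * m" "rowset T"
  proof
    show "2 \<le> b" "0 < m" by (fact assms(1) m_pos)+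
    \<comment> \<open>One further block adds to each count the length of its row in
      \<open>S\<close>, and the lower row is not longer.\<close>
    show "cnt (rowset T (Suc q)) (x + m) + cnt (rowset T q) x \<le>
        cnt (rowset T (Suc q)) x + cnt (rowset T q) (x + m)" if "x + m \<le> k * m" for q x
      using len[of q "Suc q"] cnt_rowset_tab_power[OF sk m_def range that m_pos]
      unfolding T_def by simp
  qed
  have range_T: "rowset T r \<subseteq> {1..k * m}" for r
  proof
    fix y assume "y \<in> rowset T r"
    then obtain x t where *: "y = x + t * m" "t < k" "x \<in> rowset S r"
      unfolding T_def rowset_tab_power[OF sk m_def] by blast
    have "Suc t * m \<le> k * m" using *(2) by (intro mult_le_mono1) simp
    with * range[of r] show "y \<in> {1..k * m}" by auto
  qed
  have skT: "skew_tab s (\<lambda>r. s r + k * (e r - s r)) {} T"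
    unfolding T_def by (rule skew_tab_power[OF sk m_def len range])
  have "rect_inv (b - 1) s (\<lambda>r. s r + k * (e r - s r)) T"
  proof (rule rect_inv_first_phase[OF skT refl range_T])
    show "s r < s r + k * (e r - s r)" if "r < b" for r
      using se[OF that] assms(1) by (simp add: k_def)
  qed (simp_all add: s_def e_def)
  then obtain s' e' where fin: "rect_inv 0 s' e' (Rect T)"
    using rect_inv_Rect by blast
  have "\<exists>j'. Rect T (i, j') = Some x"
    if "T (i, j) = Some x" "(k - 1) * m + 1 \<le> x" for i j x
  proof -
    \<comment> \<open>The last block starts right after \<open>k - 1 = 2 * b - 3\<close> blocks,
      just beyond the reach of every exchange.\<close>
    have "x \<in> rowset T i" using that(1) unfolding rowset_def by blast
    then have "x \<in> rowset (Rect T) i"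
      using rect_inv_stable[OF fin, of x i] that(2) k by simp
    then show ?thesis unfolding rowset_def by blast
  qed
  then show ?thesis
    unfolding stabilizes_at_def Let_def T_def k_def m_def by blast
qed

end
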